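(* Let $p\in\mathbb{N}$ and let $S$ be a VAR($p$) process with instantaneous effects, with full-time DAG $\mathcal{G}_I$. Let $A,B,C$ be finite pairwise disjoint sets of nodes of $\mathcal{G}_I$. If $A$ and $C$ are $d$-separated by $B$ in $\mathcal{G}_I$, then $A\perp\!\!\!\perp C\mid B$, i.e. the random variables in $A$ and those in $C$ are conditionally independent given those in $B$.
   Context: VAR process with instantaneous effects. A $d$-dimensional time series $S=(S_t)_{t\in\mathbb{Z}}$ follows a VAR($p$) process with instantaneous effects if there are matrices $A_0,A_1,\ldots,A_p\in\mathbb{R}^{d\times d}$ with $\mathrm{diag}(A_0)=0$ such that for all $t\in\mathbb{Z}$ $$S_t=A_0S_t+A_1S_{t-1}+\ldots+A_pS_{t-p}+\varepsilon_t,$$ where $\det((I_d-A_0)\lambda^p-A_1\lambda^{p-1}-\ldots-A_p)=0$ implies $|\lambda|<1$, and $(\varepsilon_t)_{t\in\mathbb{Z}}$ is an i.i.d. process with finite second moments and jointly independent components. $S$ is understood to be the stationary solution. Full-time DAG. It is the infinite directed graph with node set $\{S_t^i: i\in\{1,\ldots,d\},t\in\mathbb{Z}\}$ in which, for $t\in\mathbb{Z}$ and $k\in\{0,\ldots,p\}$, there is an edge $S_{t-k}^j\to S_t^i$ if and only if $(A_k)_{i,j}\neq 0$. This graph is assumed to be acyclic (equivalently, the graph of instantaneous edges, those with $k=0$, is acyclic). $d$-separation. A path is an alternating sequence $(v_1,e_1,v_2,\ldots,e_{n-1},v_n)$ of distinct vertices and edges, $e_i$ connecting $v_i$ and $v_{i+1}$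 (in either direction). A vertex $v_i$ is a collider in the path if the path has the form $\to v_i\leftarrow$ at $v_i$. $DE_{\mathcal{G}}(v)$ is the set of descendants of $v$ (nodes reachable by a directed path), including $v$ itself. A path between $v$ and $w$ is blocked by $B\subset V\setminus\{v,w\}$ if some non-collider of the path other than its endpoints is in $B$, or some collider $u$ in the path satisfies $DE_{\mathcal{G}}(u)\cap B=\emptyset$. $A$ and $C$ are $d$-separated by $B$ if every path from a node in $A$ to a node in $C$ is blocked by $B$. *)

theory Defs
  imports "HOL-Probability.Probability"
begin

section \<open>Conditional independence\<close>

definition sigma_gen :: "'w measure \<Rightarrow> ('v \<Rightarrow> 'w \<Rightarrow> real) \<Rightarrow> 'v set \<Rightarrow> 'w measure" where
  "sigma_gen M X V = vimage_algebra (space M) (\<lambda>\<omega>. \<lambda>v\<in>V. X v \<omega>) (Pi\<^sub>M V (\<lambda>_. borel))"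

definition cond_indep_vars ::
  "'w measure \<Rightarrow> ('v \<Rightarrow> 'w \<Rightarrow> real) \<Rightarrow> 'v set \<Rightarrow> 'v set \<Rightarrow> 'v set \<Rightarrow> bool" where
  "cond_indep_vars M X A C B \<longleftrightarrow>
     (\<forall>F \<in> sets (sigma_gen M X A). \<forall>G \<in> sets (sigma_gen M X C).
        AE \<omega> in M. real_cond_exp M (sigma_gen M X B) (indicator (F \<inter> G)) \<omega>
                  = real_cond_exp M (sigma_gen M X B) (indicator F) \<omega>
                    * real_cond_exp M (sigma_gen M X B) (indicator G) \<omega>)"


section \<open>Paths and d-separation\<close>

text \<open>
  A directed graph is given by its edge relation. A path carries its list of vertices and its
  list of edges; each edge may be traversed in either direction.
\<close>

definition is_path :: "('v \<times> 'v) set \<Rightarrow> 'v list \<Rightarrow> ('v \<times> 'v) list \<Rightarrow> bool" where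
  "is_path E vs es \<longleftrightarrow>
     length vs = Suc (length es) \<and> distinct vs \<and> distinct es \<and> set es \<subseteq> E \<and>
     (\<forall>i < length es. es ! i = (vs ! i, vs ! Suc i) \<or> es ! i = (vs ! Suc i, vs ! i))"

definition path_between ::
  "('v \<times> 'v) set \<Rightarrow> 'v \<Rightarrow> 'v list \<Rightarrow> ('v \<times> 'v) list \<Rightarrow> 'v \<Rightarrow> bool" where
  "path_between E a vs es c \<longleftrightarrow> is_path E vs es \<and> hd vs = a \<and> last vs = c"

definition inner_pos :: "'v list \<Rightarrow> nat \<Rightarrow> bool" where
  "inner_pos vs i \<longleftrightarrow> 0 < i \<and> Suc i < length vs"

definition collider :: "'v list \<Rightarrow> ('v \<times> 'v) list \<Rightarrow> nat \<Rightarrow> bool" where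
  "collider vs es i \<longleftrightarrow>
     inner_pos vs i \<and> es ! (i - 1) = (vs ! (i - 1), vs ! i) \<and> es ! i = (vs ! Suc i, vs ! i)"

definition descendants :: "('v \<times> 'v) set \<Rightarrow> 'v \<Rightarrow> 'v set" where
  "descendants E v = {w. (v, w) \<in> E\<^sup>*}"

definition blocked :: "('v \<times> 'v) set \<Rightarrow> 'v list \<Rightarrow> ('v \<times> 'v) list \<Rightarrow> 'v set \<Rightarrow> bool" where
  "blocked E vs es B \<longleftrightarrow>
     (\<exists>i. inner_pos vs i \<and> \<not> collider vs es i \<and> vs ! i \<in> B) \<or>
     (\<exists>i. collider vs es i \<and> descendants E (vs ! i) \<inter> B = {})"

definition d_separated :: "('v \<times> 'v) set \<Rightarrow> 'v set \<Rightarrow> 'v set \<Rightarrow> 'v set \<Rightarrow> bool" where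
  "d_separated E A C B \<longleftrightarrow>
     (\<forall>a \<in> A. \<forall>c \<in> C. \<forall>vs es. path_between E a vs es c \<longrightarrow> blocked E vs es B)"


section \<open>VAR processes with instantaneous effects\<close>

definition iid_noise :: "'w measure \<Rightarrow> (int \<Rightarrow> 'w \<Rightarrow> real^'d::finite) \<Rightarrow> bool" where
  "iid_noise M \<epsilon> \<longleftrightarrow>
     prob_space.indep_vars M (\<lambda>_. borel) \<epsilon> UNIV \<and>
     (\<forall>s t. distr M borel (\<epsilon> s) = distr M borel (\<epsilon> t)) \<and>
     (\<forall>t. integrable M (\<lambda>\<omega>. (norm (\<epsilon> t \<omega>))\<^sup>2)) \<and>
     (\<forall>t. prob_space.indep_vars M (\<lambda>_. borel) (\<lambda>i \<omega>. \<epsilon> t \<omega> $ i) UNIV)"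

definition char_matrix :: "nat \<Rightarrow> (nat \<Rightarrow> real^'d^'d) \<Rightarrow> complex \<Rightarrow> complex^'d^'d::finite" where
  "char_matrix p \<Phi> z =
     (\<chi> i j. complex_of_real ((mat 1 - \<Phi> 0) $ i $ j) * z ^ p
             - (\<Sum>k = 1..p. complex_of_real (\<Phi> k $ i $ j) * z ^ (p - k)))"

text \<open>Strict stationarity: the law of the whole trajectory is invariant under time shifts.\<close>

definition strictly_stationary :: "'w measure \<Rightarrow> (int \<Rightarrow> 'w \<Rightarrow> real^'d::finite) \<Rightarrow> bool" where
  "strictly_stationary M S \<longleftrightarrow>
     (\<forall>h. distr M (Pi\<^sub>M UNIV (\<lambda>_. borel)) (\<lambda>\<omega> t. S (t + h) \<omega>)
        = distr M (Pi\<^sub>M UNIV (\<lambda>_. borel)) (\<lambda>\<omega> t. S t \<omega>))"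

definition VAR_process ::
  "'w measure \<Rightarrow> nat \<Rightarrow> (nat \<Rightarrow> real^'d^'d::finite) \<Rightarrow> (int \<Rightarrow> 'w \<Rightarrow> real^'d)
     \<Rightarrow> (int \<Rightarrow> 'w \<Rightarrow> real^'d) \<Rightarrow> bool" where
  "VAR_process M p \<Phi> \<epsilon> S \<longleftrightarrow>
     (\<forall>i. \<Phi> 0 $ i $ i = 0) \<and>
     (\<forall>z. det (char_matrix p \<Phi> z) = 0 \<longrightarrow> norm z < 1) \<and>
     iid_noise M \<epsilon> \<and>
     (\<forall>t. S t \<in> borel_measurable M) \<and>
     (\<forall>t. AE \<omega> in M. S t \<omega> = (\<Sum>k\<le>p. \<Phi> k *v S (t - int k) \<omega>) + \<epsilon> t \<omega>) \<and>
     strictly_stationary M S"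

text \<open>The node \<open>(i, t)\<close> stands for the \<open>i\<close>-th component of the process at time \<open>t\<close>.\<close>

definition full_time_graph ::
  "nat \<Rightarrow> (nat \<Rightarrow> real^'d^'d::finite) \<Rightarrow> (('d \<times> int) \<times> ('d \<times> int)) set" where
  "full_time_graph p \<Phi> = {((j, t - int k), (i, t)) | i j t k. k \<le> p \<and> \<Phi> k $ i $ j \<noteq> 0}"

definition node_var :: "(int \<Rightarrow> 'w \<Rightarrow> real^'d::finite) \<Rightarrow> 'd \<times> int \<Rightarrow> 'w \<Rightarrow> real" where
  "node_var S v \<omega> = S (snd v) \<omega> $ fst v"

end

theory Submission
  imports Defs "HOL-Complex_Analysis.Complex_Analysis"
begin

text \<open>
  Let \<open>An\<close> be the set of ancestors of \<open>A \<union> B \<union> C\<close>. By \<open>d\<close>-separation, \<open>An - B\<close> splits into two parts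
  \<open>P \<supseteq> A\<close> and \<open>Q \<supseteq> C\<close> such that every node of \<open>An\<close> has its family inside \<open>P \<union> B\<close> or inside
  \<open>Q \<union> B\<close>. Since \<open>B\<close> is finite, it has no node before some time \<open>t0\<close>, and before \<open>t0\<close> both \<open>P\<close> and
  \<open>Q\<close> are closed under taking parents. The stationary solution at a node is almost surely a function
  of the noise at its ancestors, so the infinite pasts of \<open>P\<close> and \<open>Q\<close> are independent. The finitely
  many remaining nodes of \<open>An\<close> are added in topological order: each is a function of its parents
  and a fresh independent noise term, which preserves conditional independence of \<open>P\<close> and \<open>Q\<close>
  given \<open>B\<close>.
\<close>

section \<open>d-separation and active walks\<close>

text \<open>The obstacle is that the graph has no first node, so the usual induction along a
  topological order has nowhere to start. It is started from a whole infinite past, and finiteness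
  of \<open>B\<close> allows a past in which nothing is conditioned on, so that plain independence
  suffices there. That independence rests on inverting the lag polynomial as a power series: the
  root condition and acyclicity together make it invertible on the closed unit disc, and a nonzero
  coefficient of the inverse always marks a directed path, so only noise at ancestors occurs. The
  resulting representation holds only almost surely, hence sigma-algebras are enlarged by events
  that agree with theirs up to null sets. Conditional independence is handled in an asymmetric form
  stated through set integrals, for which adding an independent noise term is a pi-lambda argument.
  On the graph side, reachability arguments produce walks with repeated vertices, whereas
  d-separation speaks of paths, so detours must be cut out without blocking the walk.\<close>

definition active_at :: "('v \<times> 'v) set \<Rightarrow> 'v set \<Rightarrow> 'v \<Rightarrow> 'v \<Rightarrow> 'v \<Rightarrow> bool" where
  "active_at E B u v w \<longleftrightarrow>
     (if (u, v) \<in> E \<and> (w, v) \<in> E then descendants E v \<inter> B \<noteq> {} else v \<notin> B)"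

text \<open>\<open>active_at\<close> recognizes colliders from vertices alone, which is unambiguous
  because an acyclic graph has at most one edge between two vertices. Vertices may recur, and the
  two neighbours of a collider may even coincide.\<close>

definition active_walk :: "('v \<times> 'v) set \<Rightarrow> 'v set \<Rightarrow> (nat \<Rightarrow> 'v) \<Rightarrow> nat \<Rightarrow> bool" where
  "active_walk E B f n \<longleftrightarrow>
     (\<forall>i<n. (f i, f (Suc i)) \<in> E \<or> (f (Suc i), f i) \<in> E) \<and>
     (\<forall>i. Suc i < n \<longrightarrow> active_at E B (f i) (f (Suc i)) (f (Suc (Suc i))))"

lemma acyclic_asym: "acyclic E \<Longrightarrow> (u, v) \<in> E \<Longrightarrow> (v, u) \<notin> E"
  by (meson acyclic_def r_into_trancl trancl_trans)

text \<open>Following the walk from \<open>f i\<close>, the edges form a directed path until the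
  first vertex that is entered from both sides. If there were none, the last edge would point
  forward as well as backward.\<close>

lemma turning_point:
  assumes "acyclic E" and walk: "\<And>k. k < j \<Longrightarrow> (f k, f (Suc k)) \<in> E \<or> (f (Suc k), f k) \<in> E"
    and "i < j" and out: "(f i, f (Suc i)) \<in> E" and bk: "(f j, f (j - 1)) \<in> E"
  obtains k where "i < k" "k < j" "(f i, f k) \<in> E\<^sup>*" "(f (k - 1), f k) \<in> E" "(f (Suc k), f k) \<in> E"
proof (rule ccontr)
  assume "\<not> thesis"
  then have no: "\<not> (i < k \<and> k < j \<and> (f i, f k) \<in> E\<^sup>* \<and> (f (k - 1), f k) \<in> E \<and> (f (Suc k), f k) \<in> E)" for k
    using that by blast
  have "(f i, f (Suc m)) \<in> E\<^sup>* \<and> (f m, f (Suc m)) \<in> E" if "i \<le> m" "m < j" for m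
    using that
  proof (induction m rule: dec_induct)
    case base
    then show ?case using out by blast
  next
    case (step m)
    then have "(f i, f (Suc m)) \<in> E\<^sup>*" "(f m, f (Suc m)) \<in> E" by auto
    moreover from this no[of "Suc m"] have "(f (Suc (Suc m)), f (Suc m)) \<notin> E"
      using step by auto
    ultimately have "(f (Suc m), f (Suc (Suc m))) \<in> E" using walk step by blast
    then show ?case using \<open>(f i, f (Suc m)) \<in> E\<^sup>*\<close> by auto
  qed
  from this[of "j - 1"] have "(f (j - 1), f j) \<in> E" using \<open>i < j\<close> by auto
  then show False using acyclic_asym[OF \<open>acyclic E\<close>] bk by blast
qed

text \<open>A vertex \<open>v\<close> visited twice can only become a new collider after the detour is cut out if
  the detour leaves \<open>v\<close> and returns to it along edges pointing away from \<open>v\<close>; the first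
  collider on the detour is then a descendant of \<open>v\<close>.\<close>

lemma active_walk_shorten:
  assumes ac: "acyclic E" and walk: "active_walk E B f n"
    and ij: "i < j" "j \<le> n" "f i = f j"
  defines "g \<equiv> \<lambda>k. if k \<le> i then f k else f (k + (j - i))"
  shows "active_walk E B g (n - (j - i))"
  unfolding active_walk_def
proof (intro conjI allI impI)
  fix k assume k: "k < n - (j - i)"
  have adj: "\<And>k. k < n \<Longrightarrow> (f k, f (Suc k)) \<in> E \<or> (f (Suc k), f k) \<in> E"
    using walk by (auto simp: active_walk_def)
  consider "Suc k \<le> i" | "k = i" | "k > i" by linarith
  then show "(g k, g (Suc k)) \<in> E \<or> (g (Suc k), g k) \<in> E"
  proof cases
    case 1
    then show ?thesis using adj[of k] ij by (auto simp: g_def)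
  next
    case 2
    then have "g k = f j" "g (Suc k) = f (Suc j)" using ij by (auto simp: g_def)
    then show ?thesis using adj[of j] k 2 ij by auto
  next
    case 3
    then have "g k = f (k + (j - i))" "g (Suc k) = f (Suc (k + (j - i)))" by (auto simp: g_def)
    then show ?thesis using adj[of "k + (j - i)"] k 3 ij by auto
  qed
next
  fix k assume k: "Suc k < n - (j - i)"
  have adj: "\<And>k. k < n \<Longrightarrow> (f k, f (Suc k)) \<in> E \<or> (f (Suc k), f k) \<in> E"
    and act: "\<And>k. Suc k < n \<Longrightarrow> active_at E B (f k) (f (Suc k)) (f (Suc (Suc k)))"
    using walk by (auto simp: active_walk_def)
  consider "Suc k < i" | "Suc k = i" | "k = i" | "k > i" by linarith
  then show "active_at E B (g k) (g (Suc k)) (g (Suc (Suc k)))"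
  proof cases
    case 1
    then show ?thesis using act[of k] ij by (auto simp: g_def)
  next
    case 2
    have g: "g k = f k" "g (Suc k) = f i" "g (Suc (Suc k)) = f (Suc j)"
      using 2 ij by (auto simp: g_def)
    have ni: "active_at E B (f k) (f i) (f (Suc i))" using act[of k] 2 ij by auto
    have nj: "active_at E B (f (j - 1)) (f i) (f (Suc j))"
      using act[of "j - 1"] k ij 2 by auto
    show ?thesis
    proof (cases "(f k, f i) \<in> E \<and> (f (Suc j), f i) \<in> E")
      case coll: True
      have "descendants E (f i) \<inter> B \<noteq> {}"
      proof (cases "(f (Suc i), f i) \<in> E \<or> (f (j - 1), f i) \<in> E")
        case True
        then show ?thesis using ni nj coll by (auto simp: active_at_def)
      next
        case False
        then have "(f i, f (Suc i)) \<in> E" "(f j, f (j - 1)) \<in> E"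
          using adj[of i] adj[of "j - 1"] ij by auto
        then obtain m where m: "i < m" "m < j" "(f i, f m) \<in> E\<^sup>*"
          "(f (m - 1), f m) \<in> E" "(f (Suc m), f m) \<in> E"
          using turning_point[OF ac, of j f i] adj ij by (metis less_le_trans)
        from act[of "m - 1"] m ij have "descendants E (f m) \<inter> B \<noteq> {}"
          by (auto simp: active_at_def)
        then show ?thesis using m(3) by (auto simp: descendants_def dest: rtrancl_trans)
      qed
      then show ?thesis using coll g by (auto simp: active_at_def)
    next
      case False
      \<comment> \<open>One of the two edges kept at the splice leaves \<open>f i\<close>. On the
        passage of the original walk that uses this edge the vertex is a non-collider, hence outside
        \<open>B\<close>.\<close>
      have "f i \<notin> B"
        using ni nj False by (auto simp: active_at_def acyclic_asym[OF ac] split: if_splits)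
      then show ?thesis using False g by (auto simp: active_at_def)
    qed
  next
    case 3
    then have "g k = f j" "g (Suc k) = f (Suc j)" "g (Suc (Suc k)) = f (Suc (Suc j))"
      using ij by (auto simp: g_def)
    then show ?thesis using act[of j] k 3 ij by auto
  next
    case 4
    then have "g k = f (k + (j - i))" "g (Suc k) = f (Suc (k + (j - i)))"
      "g (Suc (Suc k)) = f (Suc (Suc (k + (j - i))))" by (auto simp: g_def)
    then show ?thesis using act[of "k + (j - i)"] k 4 ij by auto
  qed
qed

lemma inj_active_walk_imp_path:
  assumes ac: "acyclic E" and walk: "active_walk E B f n" and inj: "inj_on f {..n}"
  shows "\<exists>vs es. path_between E (f 0) vs es (f n) \<and> \<not> blocked E vs es B"
proof -
  define e where "e i = (if (f i, f (Suc i)) \<in> E then (f i, f (Suc i)) else (f (Suc i), f i))" for i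
  define vs where "vs = map f [0..<Suc n]"
  define es where "es = map e [0..<n]"
  have adj: "\<And>k. k < n \<Longrightarrow> (f k, f (Suc k)) \<in> E \<or> (f (Suc k), f k) \<in> E"
    and act: "\<And>k. Suc k < n \<Longrightarrow> active_at E B (f k) (f (Suc k)) (f (Suc (Suc k)))"
    using walk by (auto simp: active_walk_def)
  have len: "length vs = Suc n" "length es = n" by (auto simp: vs_def es_def)
  have vs_nth: "vs ! i = f i" if "i \<le> n" for i using that by (simp add: vs_def del: upt_Suc)
  have es_nth: "es ! i = e i" if "i < n" for i using that by (simp add: es_def)
  have "distinct vs" using inj by (simp add: vs_def distinct_map atLeast0LessThan lessThan_Suc_atMost del: upt_Suc)
  moreover have "inj_on e {..<n}"
  proof (rule inj_onI)
    fix k l assume kl: "k \<in> {..<n}" "l \<in> {..<n}" "e k = e l"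
    then have "{f k, f (Suc k)} = {f l, f (Suc l)}" by (auto simp: e_def split: if_splits)
    then have "f ` {k, Suc k} = f ` {l, Suc l}" by auto
    then have "{k, Suc k} = {l, Suc l}" 
      using inj_on_image_eq_iff[OF inj, of "{k, Suc k}" "{l, Suc l}"] kl by simp
    then show "k = l" by (auto simp: doubleton_eq_iff)
  qed
  then have "distinct es" by (simp add: es_def distinct_map atLeast0LessThan)
  moreover have "set es \<subseteq> E" using adj by (fastforce simp: es_def e_def)
  moreover have "hd vs = f 0" "last vs = f n" by (simp_all add: vs_def upt_rec[of 0] last_map del: upt_Suc) 
  ultimately have "path_between E (f 0) vs es (f n)"
    by (auto simp: path_between_def is_path_def len vs_nth es_nth e_def)
  moreover have "collider vs es i \<longleftrightarrow> (f (i - 1), f i) \<in> E \<and> (f (Suc i), f i) \<in> E"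
    if "inner_pos vs i" for i
  proof -
    have i: "0 < i" "i < n" using that by (auto simp: inner_pos_def len)
    have "i - 1 \<le> n" "i - 1 \<noteq> i" using i by auto
    then have ne: "f (i - 1) \<noteq> f i" "f i \<noteq> f (Suc i)"
      using inj_onD[OF inj, of "i - 1" i] inj_onD[OF inj, of i "Suc i"] i
      unfolding atMost_iff by (meson Suc_leI less_imp_le n_not_Suc_n)+
    have a: "(f (i - 1), f i) \<in> E \<or> (f i, f (i - 1)) \<in> E" "(f i, f (Suc i)) \<in> E \<or> (f (Suc i), f i) \<in> E"
      using adj[of "i - 1"] adj[of i] i by auto
    have "es ! (i - 1) = e (i - 1)" "es ! i = e i" using i by (auto simp: es_nth)
    moreover have "vs ! (i - 1) = f (i - 1)" "vs ! i = f i" "vs ! Suc i = f (Suc i)" using i by (auto simp: vs_nth)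
    ultimately show ?thesis
      using that a ne i acyclic_asym[OF ac] by (auto simp: collider_def e_def)
  qed
  note coll = this
  have "\<not> blocked E vs es B"
  proof -
    have "if collider vs es i then descendants E (vs ! i) \<inter> B \<noteq> {} else vs ! i \<notin> B"
      if "inner_pos vs i" for i
      unfolding coll[OF that]
      using that act[of "i - 1"] by (auto simp: inner_pos_def len vs_nth active_at_def)
    moreover have "inner_pos vs i" if "collider vs es i" for i using that by (simp add: collider_def)
    ultimately show ?thesis unfolding blocked_def by metis
  qed
  ultimately show ?thesis by blast
qed

lemma active_walk_imp_path:
  assumes "acyclic E" and "active_walk E B f n"
  shows "\<exists>vs es. path_between E (f 0) vs es (f n) \<and> \<not> blocked E vs es B"
  using assms(2)
proof (induction n arbitrary: f rule: less_induct)
  case (less n)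
  show ?case
  proof (cases "inj_on f {..n}")
    case True
    then show ?thesis using inj_active_walk_imp_path assms(1) less.prems by metis
  next
    case False
    then obtain i j where ij: "i < j" "j \<le> n" "f i = f j"
      unfolding inj_on_def by (metis atMost_iff linorder_neqE_nat)
    define g where "g = (\<lambda>k. if k \<le> i then f k else f (k + (j - i)))"
    have "active_walk E B g (n - (j - i))"
      unfolding g_def using active_walk_shorten[OF assms(1) less.prems ij] .
    moreover have "n - (j - i) < n" using ij by auto
    moreover have "g 0 = f 0" by (simp add: g_def)
    moreover have "g (n - (j - i)) = f n" using ij by (cases "j = n") (auto simp: g_def)
    ultimately show ?thesis using less.IH by metis
  qed
qed

lemma active_walk_snoc:
  assumes "active_walk E B f n" and "(f n, u) \<in> E \<or> (u, f n) \<in> E"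
    and "n \<noteq> 0 \<Longrightarrow> active_at E B (f (n - 1)) (f n) u"
  shows "active_walk E B (f(Suc n := u)) (Suc n)"
  unfolding active_walk_def
proof (intro conjI allI impI)
  fix i assume "i < Suc n"
  then show "((f(Suc n := u)) i, (f(Suc n := u)) (Suc i)) \<in> E \<or> ((f(Suc n := u)) (Suc i), (f(Suc n := u)) i) \<in> E"
    using assms by (cases "i = n") (auto simp: active_walk_def)
next
  fix i assume "Suc i < Suc n"
  then show "active_at E B ((f(Suc n := u)) i) ((f(Suc n := u)) (Suc i)) ((f(Suc n := u)) (Suc (Suc i)))"
    using assms by (cases "Suc i = n") (auto simp: active_walk_def)
qed

section \<open>Nodes that active walks from \<open>A\<close> can reach\<close>

definition reached :: "('v \<times> 'v) set \<Rightarrow> 'v set \<Rightarrow> 'v set \<Rightarrow> 'v \<Rightarrow> bool" where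
  "reached E B A v \<longleftrightarrow> (\<exists>f n. active_walk E B f n \<and> f 0 \<in> A \<and> f n = v)"

text \<open>A walk that arrives against an arrow, or has length 0, cannot make \<open>v\<close> a
  collider when prolonged. So it continues to every parent of \<open>v\<close> as soon as
  \<open>v \<notin> B\<close>.\<close>

definition reached_from_child :: "('v \<times> 'v) set \<Rightarrow> 'v set \<Rightarrow> 'v set \<Rightarrow> 'v \<Rightarrow> bool" where
  "reached_from_child E B A v \<longleftrightarrow>
     (\<exists>f n. active_walk E B f n \<and> f 0 \<in> A \<and> f n = v \<and> (n \<noteq> 0 \<longrightarrow> (f n, f (n - 1)) \<in> E))"

lemma reached_start: "a \<in> A \<Longrightarrow> reached E B A a"
  unfolding reached_def by (intro exI[of _ "\<lambda>_. a"] exI[of _ 0]) (simp add: active_walk_def)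

lemma reached_from_child_start: "a \<in> A \<Longrightarrow> reached_from_child E B A a"
  unfolding reached_from_child_def
  by (intro exI[of _ "\<lambda>_. a"] exI[of _ 0]) (simp add: active_walk_def)

lemma d_separated_not_reached:
  assumes "acyclic E" and "d_separated E A C B" and "c \<in> C"
  shows "\<not> reached E B A c"
  using assms active_walk_imp_path unfolding reached_def d_separated_def by metis

lemma reached_child:
  assumes ac: "acyclic E" and "reached E B A v" and "v \<notin> B" and e: "(v, u) \<in> E"
  shows "reached E B A u"
proof -
  obtain f n where f: "active_walk E B f n" "f 0 \<in> A" "f n = v"
    using assms by (auto simp: reached_def)
  have "active_walk E B (f(Suc n := u)) (Suc n)"
    using f assms acyclic_asym[OF ac e] by (intro active_walk_snoc) (auto simp: active_at_def)
  then show ?thesis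
    using f unfolding reached_def by (intro exI[of _ "f(Suc n := u)"] exI[of _ "Suc n"]) auto
qed

text \<open>Whether or not \<open>v\<close> becomes a collider on the prolonged walk, one of the two
  assumptions on \<open>v\<close> opens it.\<close>

lemma reached_parent:
  assumes "reached E B A v" and "v \<notin> B" and "descendants E v \<inter> B \<noteq> {}" and "(u, v) \<in> E"
  shows "reached E B A u"
proof -
  obtain f n where f: "active_walk E B f n" "f 0 \<in> A" "f n = v"
    using assms by (auto simp: reached_def)
  have "active_walk E B (f(Suc n := u)) (Suc n)"
    using f assms by (intro active_walk_snoc) (auto simp: active_at_def)
  then show ?thesis
    using f unfolding reached_def by (intro exI[of _ "f(Suc n := u)"] exI[of _ "Suc n"]) auto
qed

text \<open>Two steps at once: down to \<open>w\<close>, then up to \<open>u\<close>. The vertex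
  \<open>w\<close> is a collider opened by a descendant in \<open>B\<close>.\<close>

lemma reached_collider:
  assumes "reached E B A v" and "v \<notin> B" and "(v, w) \<in> E" and "descendants E w \<inter> B \<noteq> {}" and "(u, w) \<in> E"
    and ac: "acyclic E"
  shows "reached E B A u"
proof -
  obtain f n where f: "active_walk E B f n" "f 0 \<in> A" "f n = v"
    using assms by (auto simp: reached_def)
  have "(w, f n) \<notin> E" using f assms acyclic_asym[OF ac assms(3)] by simp
  then have "active_walk E B (f(Suc n := w)) (Suc n)"
    using f assms by (intro active_walk_snoc) (auto simp: active_at_def)
  then have "active_walk E B ((f(Suc n := w))(Suc (Suc n) := u)) (Suc (Suc n))"
    using f assms by (rule_tac active_walk_snoc) (auto simp: active_at_def)
  then show ?thesis
    using f unfolding reached_def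
    by (intro exI[of _ "(f(Suc n := w))(Suc (Suc n) := u)"] exI[of _ "Suc (Suc n)"]) auto
qed

lemma reached_from_child_parent:
  assumes ac: "acyclic E" and "reached_from_child E B A v" and "v \<notin> B" and "(u, v) \<in> E"
  shows "reached_from_child E B A u"
proof -
  obtain f n where f: "active_walk E B f n" "f 0 \<in> A" "f n = v" "n \<noteq> 0 \<longrightarrow> (f n, f (n - 1)) \<in> E"
    using assms by (auto simp: reached_from_child_def)
  have "active_walk E B (f(Suc n := u)) (Suc n)"
    using f assms acyclic_asym[OF ac] by (intro active_walk_snoc) (auto simp: active_at_def)
  then show ?thesis
    using f assms unfolding reached_from_child_def
    by (intro exI[of _ "f(Suc n := u)"] exI[of _ "Suc n"]) auto
qed

lemma reached_from_child_imp_reached: "reached_from_child E B A v \<Longrightarrow> reached E B A v"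
  by (auto simp: reached_def reached_from_child_def)

lemma not_desc_step:
  "descendants E v \<inter> B = {} \<Longrightarrow> (v, u) \<in> E\<^sup>* \<Longrightarrow> u \<notin> B"
  by (auto simp: descendants_def)

lemma reached_descendant:
  assumes ac: "acyclic E" and "reached E B A v" and no: "descendants E v \<inter> B = {}" and "(v, u) \<in> E\<^sup>*"
  shows "reached E B A u"
  using assms(4)
proof (induction rule: rtrancl_induct)
  case (step y z)
  then show ?case using reached_child[OF ac _ not_desc_step[OF no]] by blast
qed fact

text \<open>The directed path from \<open>v\<close> to \<open>a\<close> is walked backwards; all its
  vertices are descendants of \<open>v\<close> and hence outside \<open>B\<close>.\<close>

lemma reached_from_child_ancestor:
  assumes ac: "acyclic E" and "a \<in> A" and "(v, a) \<in> E\<^sup>*" and "descendants E v \<inter> B = {}"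
  shows "reached_from_child E B A v"
  using assms(3,4)
proof (induction rule: converse_rtrancl_induct)
  case base
  then show ?case using reached_from_child_start assms(2) by metis
next
  case (step v w)
  have "descendants E w \<inter> B = {}"
    using step by (auto simp: descendants_def dest: converse_rtrancl_into_rtrancl)
  moreover from this have "w \<notin> B" by (auto simp: descendants_def)
  ultimately show ?case using step reached_from_child_parent[OF ac] by blast
qed

section \<open>Splitting the ancestral set along the moral graph\<close>

definition ancestors :: "('v \<times> 'v) set \<Rightarrow> 'v set \<Rightarrow> 'v set" where
  "ancestors E V = {v. \<exists>w\<in>V. (v, w) \<in> E\<^sup>*}"

definition family :: "('v \<times> 'v) set \<Rightarrow> 'v \<Rightarrow> 'v set" where
  "family E v = insert v {u. (u, v) \<in> E}"

text \<open>The relation below is the moral graph of the ancestral set, with \<open>B\<close> removed.\<close>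

lemma d_separated_imp_split:
  assumes ac: "acyclic E" and sep: "d_separated E A C B"
    and disj: "A \<inter> B = {}" "B \<inter> C = {}"
  defines "An \<equiv> ancestors E (A \<union> B \<union> C)"
  obtains A' C' where "A' \<inter> C' = {}" "A' \<union> C' = An - B" "A \<subseteq> A'" "C \<subseteq> C'"
    "\<And>w. w \<in> An \<Longrightarrow> family E w \<subseteq> A' \<union> B \<or> family E w \<subseteq> C' \<union> B"
proof -
  define Mo where "Mo = {(v, u). v \<in> An - B \<and> u \<in> An - B \<and> (\<exists>w\<in>An. v \<in> family E w \<and> u \<in> family E w)}"
  define A' where "A' = Mo\<^sup>* `` A"
  have AnA: "A \<subseteq> An" "C \<subseteq> An" "B \<subseteq> An" by (auto simp: An_def ancestors_def)
  have cl: "u \<in> An" if "w \<in> An" "u \<in> family E w" for u w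
    using that by (auto simp: An_def ancestors_def family_def dest: converse_rtrancl_into_rtrancl)
  \<comment> \<open>A node of \<open>An\<close> leads to \<open>A\<close>, \<open>B\<close> or
    \<open>C\<close>. If it does not lead to \<open>B\<close>, a directed path to \<open>C\<close>
    would carry the active walk there, against d-separation; so it leads to \<open>A\<close>, and is
    reached by walking backwards from there.\<close>
  have key: "descendants E v \<inter> B \<noteq> {} \<or> reached_from_child E B A v"
    if v: "v \<in> An" "reached E B A v" for v
  proof (rule ccontr)
    assume a: "\<not> ?thesis"
    then have no: "descendants E v \<inter> B = {}" by blast
    from v obtain w where w: "w \<in> A \<union> B \<union> C" "(v, w) \<in> E\<^sup>*" by (auto simp: An_def ancestors_def)
    from w no have "w \<notin> B" by (auto simp: descendants_def)
    moreover have "w \<notin> A" using reached_from_child_ancestor[OF ac _ w(2) no] a by blast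
    moreover have "w \<notin> C"
      using reached_descendant[OF ac v(2) no w(2)] d_separated_not_reached[OF ac sep] by blast
    ultimately show False using w by blast
  qed
  have step: "reached E B A u" if vu: "(v, u) \<in> Mo" "reached E B A v" for u v
  proof -
    from vu obtain w where w: "w \<in> An" "v \<in> family E w" "u \<in> family E w"
      and v: "v \<in> An" "v \<notin> B" and u: "u \<in> An" "u \<notin> B" by (auto simp: Mo_def)
    consider "u = v" | "u \<noteq> v" "v = w" | "u \<noteq> v" "u = w" "v \<noteq> w" | "(v, w) \<in> E" "(u, w) \<in> E"
      using w by (auto simp: family_def)
    then show ?thesis
    proof cases
      case 1
      then show ?thesis using vu by simp
    next
      case 2
      then have "(u, v) \<in> E" using w by (auto simp: family_def)
      then show ?thesis
        using key[OF v(1) vu(2)] reached_parent[OF vu(2) v(2)]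
          reached_from_child_parent[OF ac _ v(2)] reached_from_child_imp_reached by metis
    next
      case 3
      then have "(v, u) \<in> E" using w by (auto simp: family_def)
      then show ?thesis using reached_child[OF ac vu(2) v(2)] by blast
    next
      case 4
      show ?thesis
      proof (cases "descendants E w \<inter> B = {}")
        \<comment> \<open>As a collider \<open>w\<close> would be closed. But \<open>w\<close> is
          itself reached, so \<open>key\<close> supplies a walk that starts at \<open>w\<close> or
          arrives there from a child, and this one continues to every parent.\<close>
        case True
        have "reached E B A w" using reached_child[OF ac vu(2) v(2) 4(1)] .
        then have "reached_from_child E B A w" using key[OF w(1)] True by blast
        moreover have "w \<notin> B" using True by (auto simp: descendants_def)
        ultimately show ?thesis
          using reached_from_child_parent[OF ac _ _ 4(2)] reached_from_child_imp_reached by metis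
      next
        case False
        then show ?thesis using reached_collider[OF vu(2) v(2) 4(1) _ 4(2) ac] by blast
      qed
    qed
  qed
  have "reached E B A v" if "(a, v) \<in> Mo\<^sup>*" "a \<in> A" for a v
    using that by (induction rule: rtrancl_induct) (auto intro: reached_start step)
  then have "A' \<inter> C = {}"
    using d_separated_not_reached[OF ac sep] by (auto simp: A'_def)
  moreover have "A' \<subseteq> An - B"
  proof
    fix v assume "v \<in> A'"
    then obtain a where "a \<in> A" "(a, v) \<in> Mo\<^sup>*" by (auto simp: A'_def)
    from this(2,1) show "v \<in> An - B"
      using AnA disj by (cases rule: rtranclE) (auto simp: Mo_def)
  qed
  moreover have "A \<subseteq> A'" by (auto simp: A'_def)
  \<comment> \<open>Outside \<open>B\<close> a family is a clique of the moral graph, so one member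
    in the component set \<open>A'\<close> brings in all others.\<close>
  moreover have "family E w \<subseteq> A' \<union> B \<or> family E w \<subseteq> (An - B - A') \<union> B" if "w \<in> An" for w
  proof (cases "family E w \<inter> A' = {}")
    case True
    then show ?thesis using cl[OF that] by auto
  next
    case False
    then obtain v a where v: "v \<in> family E w" "a \<in> A" "(a, v) \<in> Mo\<^sup>*" "v \<in> An - B"
      using \<open>A' \<subseteq> An - B\<close> by (auto simp: A'_def)
    have "u \<in> A' \<union> B" if "u \<in> family E w" for u
    proof (cases "u \<in> B")
      case False
      then have "(v, u) \<in> Mo" using v that cl[OF \<open>w \<in> An\<close>] \<open>w \<in> An\<close> by (auto simp: Mo_def)
      then show ?thesis using v by (auto simp: A'_def intro: rtrancl_into_rtrancl)
    qed simp
    then show ?thesis by blast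
  qed
  ultimately show thesis
    using that[of A' "An - B - A'"] AnA disj by blast
qed


section \<open>Conditional independence of sub-sigma-algebras\<close>

lemma space_sigma_gen [simp]: "space (sigma_gen M X V) = space M"
  by (simp add: sigma_gen_def)

lemma measurable_sigma_gen:
  assumes "v \<in> V"
  shows "X v \<in> borel_measurable (sigma_gen M X V)"
proof -
  have "(\<lambda>\<omega>. \<lambda>v\<in>V. X v \<omega>) \<in> sigma_gen M X V \<rightarrow>\<^sub>M Pi\<^sub>M V (\<lambda>_. borel)"
    unfolding sigma_gen_def by (rule measurable_vimage_algebra1) (auto simp: space_PiM)
  from measurable_compose[OF this measurable_component_singleton[OF assms]]
  show ?thesis using assms by simp
qed

lemma sigma_gen_subset:
  assumes "space T = space M" and "\<And>v. v \<in> V \<Longrightarrow> X v \<in> borel_measurable T"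
  shows "sets (sigma_gen M X V) \<subseteq> sets T"
proof -
  have "(\<lambda>\<omega>. \<lambda>v\<in>V. X v \<omega>) \<in> T \<rightarrow>\<^sub>M Pi\<^sub>M V (\<lambda>_. borel)"
    using assms(2) by (rule measurable_restrict)
  from measurable_sets[OF this] show ?thesis
    using assms(1) sets.top[of T] unfolding sigma_gen_def sets_vimage_algebra
    by (intro sets.sigma_sets_subset') auto
qed

lemma subalgebra_sigma_gen:
  assumes "\<And>v. v \<in> V \<Longrightarrow> X v \<in> borel_measurable M"
  shows "subalgebra M (sigma_gen M X V)"
  using sigma_gen_subset[of M M V X] assms by (auto simp: subalgebra_def)

lemma sigma_gen_mono: "V \<subseteq> W \<Longrightarrow> sets (sigma_gen M X V) \<subseteq> sets (sigma_gen M X W)"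
  by (rule sigma_gen_subset) (auto intro: measurable_sigma_gen)

text \<open>A pi-system generating the join of two sigma-algebras; identities between set integrals
  are checked on it only.\<close>

definition pairwise_Int :: "'w set set \<Rightarrow> 'w set set \<Rightarrow> 'w set set" where
  "pairwise_Int P Q = {F \<inter> G | F G. F \<in> P \<and> G \<in> Q}"

lemma Int_stable_pairwise_Int: "Int_stable (pairwise_Int (sets P) (sets Q))"
  unfolding Int_stable_def pairwise_Int_def
proof safe
  fix F G F' G' assume "F \<in> sets P" "G \<in> sets Q" "F' \<in> sets P" "G' \<in> sets Q"
  then show "\<exists>F'' G''. F \<inter> G \<inter> (F' \<inter> G') = F'' \<inter> G'' \<and> F'' \<in> sets P \<and> G'' \<in> sets Q"
    by (intro exI[of _ "F \<inter> F'"] exI[of _ "G \<inter> G'"]) auto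
qed

lemma sets_subset_pairwise_Int:
  assumes "space P = \<Omega>" and "space Q = \<Omega>"
  shows "sets P \<subseteq> pairwise_Int (sets P) (sets Q)" "sets Q \<subseteq> pairwise_Int (sets P) (sets Q)"
proof -
  show "sets P \<subseteq> pairwise_Int (sets P) (sets Q)"
  proof
    fix F assume "F \<in> sets P"
    then have "F = F \<inter> space Q" using sets.sets_into_space[of F P] assms by auto
    with \<open>F \<in> sets P\<close> show "F \<in> pairwise_Int (sets P) (sets Q)"
      unfolding pairwise_Int_def by blast
  qed
  show "sets Q \<subseteq> pairwise_Int (sets P) (sets Q)"
  proof
    fix F assume "F \<in> sets Q"
    then have "F = space P \<inter> F" using sets.sets_into_space[of F Q] assms by auto
    with \<open>F \<in> sets Q\<close> show "F \<in> pairwise_Int (sets P) (sets Q)"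
      unfolding pairwise_Int_def by blast
  qed
qed

lemma sigma_gen_subset_pairwise_Int:
  assumes "space P = space M" and "space Q = space M"
    and "\<And>v. v \<in> V \<Longrightarrow>
      X v \<in> borel_measurable (sigma (space M) (pairwise_Int (sets P) (sets Q)))"
  shows "sets (sigma_gen M X V) \<subseteq> sigma_sets (space M) (pairwise_Int (sets P) (sets Q))"
proof -
  have "pairwise_Int (sets P) (sets Q) \<subseteq> Pow (space M)"
    using assms(1,2) sets.sets_into_space by (fastforce simp: pairwise_Int_def)
  then show ?thesis
    using sigma_gen_subset[of "sigma (space M) (pairwise_Int (sets P) (sets Q))" M V X] assms
    by (simp add: space_measure_of_conv)
qed

lemma subalgebra_sigma_pairwise_Int:
  assumes "space P = \<Omega>" and "space Q = \<Omega>"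
  shows "subalgebra (sigma \<Omega> (pairwise_Int (sets P) (sets Q))) P"
    "subalgebra (sigma \<Omega> (pairwise_Int (sets P) (sets Q))) Q"
proof -
  have "pairwise_Int (sets P) (sets Q) \<subseteq> Pow \<Omega>"
    using assms sets.sets_into_space by (fastforce simp: pairwise_Int_def)
  then show "subalgebra (sigma \<Omega> (pairwise_Int (sets P) (sets Q))) P"
    "subalgebra (sigma \<Omega> (pairwise_Int (sets P) (sets Q))) Q"
    using sets_subset_pairwise_Int[OF assms] assms
    by (auto simp: subalgebra_def space_measure_of_conv)
qed

lemma sigma_gen_Un_subset:
  "sets (sigma_gen M X (V \<union> W)) \<subseteq>
     sigma_sets (space M) (pairwise_Int (sets (sigma_gen M X V)) (sets (sigma_gen M X W)))"
proof (rule sigma_gen_subset_pairwise_Int)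
  fix v assume "v \<in> V \<union> W"
  then show "X v \<in> borel_measurable (sigma (space M)
      (pairwise_Int (sets (sigma_gen M X V)) (sets (sigma_gen M X W))))"
    by (auto intro: measurable_from_subalg[OF subalgebra_sigma_pairwise_Int(1)]
        measurable_from_subalg[OF subalgebra_sigma_pairwise_Int(2)] measurable_sigma_gen)
qed simp_all

text \<open>The pi-lambda argument: the sets on which the integrals agree are closed under disjoint
  countable unions, and under complements because \<open>space M \<in> \<G>\<close> makes the total
  integrals agree.\<close>

lemma set_integral_eq_sigma_sets:
  fixes f g :: "'w \<Rightarrow> real"
  assumes f: "integrable M f" and g: "integrable M g"
    and \<G>: "Int_stable \<G>" "\<G> \<subseteq> sets M" "space M \<in> \<G>"
    and eq: "\<And>K. K \<in> \<G> \<Longrightarrow> (LINT x:K|M. f x) = (LINT x:K|M. g x)"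
    and K: "K \<in> sigma_sets (space M) \<G>"
  shows "(LINT x:K|M. f x) = (LINT x:K|M. g x)"
proof -
  have sub: "sigma_sets (space M) \<G> \<subseteq> sets M"
    using \<G>(2) by (rule sets.sigma_sets_subset)
  have si: "set_integrable M A f" "set_integrable M A g" if "A \<in> sets M" for A
    using that f g by (auto simp: set_integrable_def intro: integrable_mult_indicator simp del: real_scaleR_def)
  have "\<G> \<subseteq> Pow (space M)" using \<G>(2) sets.sets_into_space by blast
  from \<G>(1) this K show ?thesis
  proof (induction rule: sigma_sets_induct_disjoint)
    case (basic A)
    then show ?case by (rule eq)
  next
    case empty
    then show ?case by (simp add: set_lebesgue_integral_def)
  next
    case (compl A)
    then have A: "A \<in> sets M" using sub by auto
    have *: "(LINT x:space M - A|M. h x) = (LINT x:space M|M. h x) - (LINT x:A|M. h x)"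
      if "integrable M h" for h :: "'w \<Rightarrow> real"
    proof -
      have "(LINT x:space M|M. h x) = (LINT x:A \<union> (space M - A)|M. h x)"
        using sets.sets_into_space[OF A] by (simp add: Un_absorb1)
      also have "\<dots> = (LINT x:A|M. h x) + (LINT x:space M - A|M. h x)"
        using A that by (intro set_integral_Un)
          (auto simp: set_integrable_def intro!: integrable_mult_indicator[where 'b=real, simplified])
      finally show ?thesis by simp
    qed
    show ?case using *[OF f] *[OF g] eq[OF \<G>(3)] compl by simp
  next
    case (union A)
    then have "range A \<subseteq> sets M" using sub by auto
    then have "A i \<in> sets M" "(\<Union>i. A i) \<in> sets M" for i by auto
    then show ?case
      using union si by (simp add: lebesgue_integral_countable_add disjoint_family_on_def)
  qed
qed

text \<open>For \<open>R\<close> a subalgebra of \<open>K\<close> this says that \<open>K\<close> and \<open>Q\<close> are conditionally independent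
  given \<open>R\<close>: the function \<open>g\<close> is the conditional probability of \<open>G\<close> given \<open>K\<close>, and it is already
  measurable with respect to \<open>R\<close>.\<close>

definition cind :: "'w measure \<Rightarrow> 'w measure \<Rightarrow> 'w measure \<Rightarrow> 'w measure \<Rightarrow> bool" where
  "cind M K Q R \<longleftrightarrow>
     (\<forall>G\<in>sets Q. \<exists>g\<in>borel_measurable R. integrable M g \<and>
        (\<forall>F\<in>sets K. (LINT x:F|M. indicat_real G x) = (LINT x:F|M. g x)))"

text \<open>The same \<open>g\<close> serves, since it stays measurable for the finer
  \<open>R'\<close>. If \<open>R'\<close> grows while remaining inside \<open>K\<close>, this is the
  weak union property.\<close>

lemma cind_mono:
  assumes "cind M K Q R" and "sets K' \<subseteq> sets K" and "sets Q' \<subseteq> sets Q" and "subalgebra R' R"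
  shows "cind M K' Q' R'"
  unfolding cind_def
proof
  fix G assume "G \<in> sets Q'"
  then obtain g where "g \<in> borel_measurable R" "integrable M g"
      "\<forall>F\<in>sets K. (LINT x:F|M. indicat_real G x) = (LINT x:F|M. g x)"
    using assms(1,3) unfolding cind_def by blast
  then show "\<exists>g\<in>borel_measurable R'. integrable M g \<and>
        (\<forall>F\<in>sets K'. (LINT x:F|M. indicat_real G x) = (LINT x:F|M. g x))"
    using assms measurable_from_subalg[OF assms(4)] by (intro bexI[of _ g]) auto
qed

context prob_space
begin

lemma sigma_finite_subalgebraI: "subalgebra M F \<Longrightarrow> sigma_finite_subalgebra M F"
  by (intro finite_measure_subalgebra_is_sigma_finite)
    (simp add: finite_measure_subalgebra_def finite_measure_subalgebra_axioms_def finite_measure_axioms)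

lemma integrable_indicator_event: "F \<in> events \<Longrightarrow> integrable M (indicator F :: _ \<Rightarrow> real)"
  by (simp add: emeasure_eq_measure)

text \<open>The identities on \<open>K\<close> include those on \<open>R\<close>, which characterize
  the conditional expectation; so \<open>g\<close> is a version of P(G | R).\<close>

lemma cind_real_cond_exp:
  assumes R: "subalgebra M R" "sets R \<subseteq> sets K" and "G \<in> events"
    and g: "g \<in> borel_measurable R" "integrable M g"
    and eq: "\<And>F. F \<in> sets K \<Longrightarrow> (LINT x:F|M. indicat_real G x) = (LINT x:F|M. g x)"
  shows "AE x in M. real_cond_exp M R (indicator G) x = g x"
proof -
  interpret R: sigma_finite_subalgebra M R using R(1) by (rule sigma_finite_subalgebraI)
  show ?thesis
    using assms by (intro R.real_cond_exp_charact) (auto simp: integrable_indicator_event)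
qed

lemma set_integral_cond_exp:
  assumes R: "subalgebra M R" and H: "H \<in> sets R" and F: "F \<in> events"
    and g: "g \<in> borel_measurable R" "integrable M g"
  shows "(LINT x:H|M. g x * real_cond_exp M R (indicator F) x) = (LINT x:F \<inter> H|M. g x)"
    "integrable M (\<lambda>x. g x * real_cond_exp M R (indicator F) x)"
proof -
  interpret R: sigma_finite_subalgebra M R using R(1) by (rule sigma_finite_subalgebraI)
  have HM: "H \<in> events" using H R by (auto simp: subalgebra_def)
  have m: "(\<lambda>x. indicator H x * g x) \<in> borel_measurable R" using H g by auto
  have i: "integrable M (\<lambda>x. (indicator H x * g x) * indicator F x)"
    using integrable_mult_indicator[OF F integrable_mult_indicator[OF HM g(2)]]
    by (simp add: ac_simps)
  have i': "integrable M (\<lambda>x. g x * indicator F x)"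
    using integrable_mult_indicator[OF F g(2)] by (simp add: ac_simps)
  show "(LINT x:H|M. g x * real_cond_exp M R (indicator F) x) = (LINT x:F \<inter> H|M. g x)"
    using R.real_cond_exp_intg(2)[OF i m] F
    by (simp add: set_lebesgue_integral_def indicator_inter_arith ac_simps)
  show "integrable M (\<lambda>x. g x * real_cond_exp M R (indicator F) x)"
    using R.real_cond_exp_intg(1)[OF i' g(1)] F by simp
qed

text \<open>This turns the asymmetric \<open>cind\<close> into a symmetric factorization. The
  witness \<open>g\<close> is integrated over \<open>F \<inter> H\<close>, a set of
  \<open>K\<close>; being \<open>R\<close>-measurable, it allows the indicator of \<open>F\<close>
  to be replaced by its conditional expectation.\<close>

lemma cind_factor:
  assumes ci: "cind M K Q R" and sub: "subalgebra M K" "subalgebra M Q" "subalgebra M R"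
    and RK: "sets R \<subseteq> sets K" and F: "F \<in> sets K" and G: "G \<in> sets Q" and H: "H \<in> sets R"
  shows "measure M (F \<inter> G \<inter> H) =
      (LINT x:H|M. real_cond_exp M R (indicator G) x * real_cond_exp M R (indicator F) x)"
    "(LINT x:G \<inter> H|M. real_cond_exp M R (indicator F) x) = measure M (F \<inter> G \<inter> H)"
    "integrable M (\<lambda>x. real_cond_exp M R (indicator G) x * real_cond_exp M R (indicator F) x)"
proof -
  interpret R: sigma_finite_subalgebra M R using sub(3) by (rule sigma_finite_subalgebraI)
  have ev: "F \<in> events" "G \<in> events" "H \<in> events" using assms by (auto simp: subalgebra_def)
  define f' where "f' = real_cond_exp M R (indicator F)"
  define g' where "g' = real_cond_exp M R (indicator G)"
  have m: "f' \<in> borel_measurable R" "g' \<in> borel_measurable R" "integrable M f'" "integrable M g'"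
    by (auto simp: f'_def g'_def intro!: R.real_cond_exp_int integrable_indicator_event ev)
  obtain g where g: "g \<in> borel_measurable R" "integrable M g"
      "\<And>F. F \<in> sets K \<Longrightarrow> (LINT x:F|M. indicat_real G x) = (LINT x:F|M. g x)"
    using ci G by (auto simp: cind_def)
  have ae: "AE x in M. g' x = g x"
    unfolding g'_def using cind_real_cond_exp[OF sub(3) RK ev(2) g] by blast
  have FH: "F \<inter> H \<in> sets K" using F H RK by auto
  have "measure M (F \<inter> G \<inter> H) = (LINT x:F \<inter> H|M. indicat_real G x)"
    using ev by (simp add: set_lebesgue_integral_def flip: indicator_inter_arith) (simp add: Int_ac)
  also have "\<dots> = (LINT x:F \<inter> H|M. g x)" using g(3)[OF FH] .
  also have "\<dots> = (LINT x:F \<inter> H|M. g' x)"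
    using ae g m ev by (intro set_lebesgue_integral_cong_AE) (auto)
  also have "\<dots> = (LINT x:H|M. g' x * f' x)"
    unfolding f'_def using set_integral_cond_exp(1)[OF sub(3) H ev(1) m(2,4)] by simp
  finally show 1: "measure M (F \<inter> G \<inter> H) =
      (LINT x:H|M. real_cond_exp M R (indicator G) x * real_cond_exp M R (indicator F) x)"
    by (simp add: f'_def g'_def)
  show "(LINT x:G \<inter> H|M. real_cond_exp M R (indicator F) x) = measure M (F \<inter> G \<inter> H)"
    using set_integral_cond_exp(1)[OF sub(3) H ev(2) m(1,3)] 1 by (simp add: f'_def g'_def ac_simps)
  show "integrable M (\<lambda>x. real_cond_exp M R (indicator G) x * real_cond_exp M R (indicator F) x)"
    using set_integral_cond_exp(2)[OF sub(3) H ev(1) m(2,4)] by (simp add: g'_def)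
qed

text \<open>The witness for \<open>F\<close> is P(F | R). On sets \<open>G \<inter> H\<close> the
  symmetric factorization gives the identity, and the pi-lambda argument extends it to the join of
  \<open>Q\<close> and \<open>R\<close>.\<close>

lemma cind_sym:
  assumes ci: "cind M K Q R" and sub: "subalgebra M K" "subalgebra M Q" "subalgebra M R"
    and RK: "sets R \<subseteq> sets K" and PK: "sets P \<subseteq> sets K"
    and K': "sets K' \<subseteq> sigma_sets (space M) (pairwise_Int (sets Q) (sets R))"
  shows "cind M K' P R"
  unfolding cind_def
proof
  interpret R: sigma_finite_subalgebra M R using sub(3) by (rule sigma_finite_subalgebraI)
  fix F assume "F \<in> sets P"
  then have F: "F \<in> sets K" "F \<in> events" using PK sub(1) by (auto simp: subalgebra_def)
  have int: "integrable M (real_cond_exp M R (indicator F))"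
    using F by (intro R.real_cond_exp_int integrable_indicator_event)
  have "(LINT x:A|M. indicat_real F x) = (LINT x:A|M. real_cond_exp M R (indicator F) x)"
    if "A \<in> sets K'" for A
  proof (rule set_integral_eq_sigma_sets[of M _ _ "pairwise_Int (sets Q) (sets R)"])
    show "A \<in> sigma_sets (space M) (pairwise_Int (sets Q) (sets R))" using that K' by blast
    show "pairwise_Int (sets Q) (sets R) \<subseteq> events"
      using sub by (auto simp: pairwise_Int_def subalgebra_def)
    show "space M \<in> pairwise_Int (sets Q) (sets R)"
      using sets_subset_pairwise_Int(1)[of Q "space M" R] sub sets.top[of Q]
      by (auto simp: subalgebra_def)
  next
    fix B assume "B \<in> pairwise_Int (sets Q) (sets R)"
    then obtain G H where B: "B = G \<inter> H" "G \<in> sets Q" "H \<in> sets R"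
      by (auto simp: pairwise_Int_def)
    have ev: "G \<in> events" "H \<in> events" using B sub by (auto simp: subalgebra_def)
    have "(LINT x:B|M. indicat_real F x) = measure M (F \<inter> G \<inter> H)"
      using ev F B by (simp add: set_lebesgue_integral_def flip: indicator_inter_arith) (simp add: Int_ac)
    then show "(LINT x:B|M. indicat_real F x) = (LINT x:B|M. real_cond_exp M R (indicator F) x)"
      using cind_factor(2)[OF ci sub RK F(1) B(2,3)] B by simp
  qed (use F int in \<open>auto simp: Int_stable_pairwise_Int integrable_indicator_event\<close>)
  then show "\<exists>g\<in>borel_measurable R. integrable M g \<and>
        (\<forall>A\<in>sets K'. (LINT x:A|M. indicat_real F x) = (LINT x:A|M. g x))"
    using int by (intro bexI[of _ "real_cond_exp M R (indicator F)"]) auto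
qed

lemma cind_imp_cond_exp_mult:
  assumes ci: "cind M K Q R" and sub: "subalgebra M K" "subalgebra M Q" "subalgebra M R"
    and RK: "sets R \<subseteq> sets K" and F: "F \<in> sets K" and G: "G \<in> sets Q"
  shows "AE x in M. real_cond_exp M R (indicator (F \<inter> G)) x =
           real_cond_exp M R (indicator F) x * real_cond_exp M R (indicator G) x"
proof -
  interpret R: sigma_finite_subalgebra M R using sub(3) by (rule sigma_finite_subalgebraI)
  have ev: "F \<in> events" "G \<in> events" using assms by (auto simp: subalgebra_def)
  note fac = cind_factor[OF ci sub RK F G]
  show ?thesis
  proof (rule R.real_cond_exp_charact)
    fix H assume H: "H \<in> sets R"
    then have "H \<in> events" using sub by (auto simp: subalgebra_def)
    then show "(LINT x:H|M. indicat_real (F \<inter> G) x) =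
        (LINT x:H|M. real_cond_exp M R (indicator F) x * real_cond_exp M R (indicator G) x)"
      using fac(1)[OF H] ev
      by (simp add: set_lebesgue_integral_def flip: indicator_inter_arith) (simp add: ac_simps)
  next
    show "integrable M (\<lambda>x. real_cond_exp M R (indicator F) x * real_cond_exp M R (indicator G) x)"
      using fac(3)[OF sets.top] by (simp add: mult.commute)
  qed (use ev in \<open>auto intro!: integrable_indicator_event\<close>)
qed

text \<open>The old witness survives: for \<open>D\<close> independent of \<open>J\<close> and
  \<open>h\<close> measurable for \<open>J\<close>, the integral of \<open>h\<close> over
  \<open>F \<inter> D\<close> is \<open>prob D\<close> times that over \<open>F\<close>. This
  applies to the indicator of \<open>G\<close> and to \<open>g\<close>, both measurable for
  \<open>J\<close>.\<close>

lemma cind_extend: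
  assumes ci: "cind M K Q R" and sub: "subalgebra M J" "subalgebra M T" "subalgebra J K" "subalgebra J Q"
    "subalgebra J R"
    and ind: "\<And>D F. D \<in> sets T \<Longrightarrow> F \<in> sets J \<Longrightarrow> prob (D \<inter> F) = prob D * prob F"
    and K': "sets K' \<subseteq> sigma_sets (space M) (pairwise_Int (sets K) (sets T))"
  shows "cind M K' Q R"
  unfolding cind_def
proof
  interpret J: sigma_finite_subalgebra M J using sub(1) by (rule sigma_finite_subalgebraI)
  fix G assume "G \<in> sets Q"
  then have G: "G \<in> sets J" "G \<in> events" using sub by (auto simp: subalgebra_def)
  obtain g where g: "g \<in> borel_measurable R" "integrable M g"
      "\<And>F. F \<in> sets K \<Longrightarrow> (LINT x:F|M. indicat_real G x) = (LINT x:F|M. g x)"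
    using ci \<open>G \<in> sets Q\<close> by (auto simp: cind_def)
  have gJ: "g \<in> borel_measurable J" using measurable_from_subalg[OF sub(5) g(1)] .
  have "(LINT x:A|M. indicat_real G x) = (LINT x:A|M. g x)" if "A \<in> sets K'" for A
  proof (rule set_integral_eq_sigma_sets[of M _ _ "pairwise_Int (sets K) (sets T)"])
    show "A \<in> sigma_sets (space M) (pairwise_Int (sets K) (sets T))" using that K' by blast
    have "sets K \<subseteq> events" "sets T \<subseteq> events" using sub by (auto simp: subalgebra_def)
    then show "pairwise_Int (sets K) (sets T) \<subseteq> events"
      by (auto simp: pairwise_Int_def)
    show "space M \<in> pairwise_Int (sets K) (sets T)"
      using sets_subset_pairwise_Int(1)[of K "space M" T] sub sets.top[of K]
      by (auto simp: subalgebra_def)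
  next
    fix B assume "B \<in> pairwise_Int (sets K) (sets T)"
    then obtain F D where B: "B = F \<inter> D" "F \<in> sets K" "D \<in> sets T"
      by (auto simp: pairwise_Int_def)
    have FJ: "F \<in> sets J" using B sub by (auto simp: subalgebra_def)
    have ev: "F \<in> events" "D \<in> events" using B FJ sub by (auto simp: subalgebra_def)
    have ae: "AE x in M. real_cond_exp M J (indicator D) x = prob D"
    proof (rule J.real_cond_exp_charact)
      fix L assume L: "L \<in> sets J"
      then have "L \<in> events" using sub by (auto simp: subalgebra_def)
      then show "(LINT x:L|M. indicat_real D x) = (LINT x:L|M. prob D)"
        using ind[OF B(3) L] ev
        by (simp add: set_lebesgue_integral_def flip: indicator_inter_arith) (simp add: ac_simps)
    qed (use ev in \<open>auto intro!: integrable_indicator_event\<close>)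
    have *: "(LINT x:B|M. h x) = prob D * (LINT x:F|M. h x)"
      if h: "h \<in> borel_measurable J" "integrable M h" for h
    proof -
      have "(LINT x:B|M. h x) = (LINT x:F|M. h x * real_cond_exp M J (indicator D) x)"
        using set_integral_cond_exp(1)[OF sub(1) FJ ev(2) h] B by (simp add: Int_commute)
      also have "\<dots> = (LINT x:F|M. h x * prob D)"
        using ae h ev by (intro set_lebesgue_integral_cong_AE) auto
      finally show ?thesis by (simp add: set_lebesgue_integral_def ac_simps)
    qed
    show "(LINT x:B|M. indicat_real G x) = (LINT x:B|M. g x)"
      using *[OF gJ g(2)] *[of "indicator G"] G g(3)[OF B(2)] integrable_indicator_event by auto
  qed (use G g in \<open>auto simp: Int_stable_pairwise_Int integrable_indicator_event\<close>)
  then show "\<exists>g\<in>borel_measurable R. integrable M g \<and>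
        (\<forall>A\<in>sets K'. (LINT x:A|M. indicat_real G x) = (LINT x:A|M. g x))"
    using g by auto
qed

text \<open>The witness is the constant \<open>prob G\<close>, measurable for every
  \<open>R\<close>.\<close>

lemma cind_indep:
  assumes "\<And>F G. F \<in> sets K \<Longrightarrow> G \<in> sets Q \<Longrightarrow> prob (F \<inter> G) = prob F * prob G"
    and "subalgebra M K" "subalgebra M Q"
  shows "cind M K Q R"
  unfolding cind_def
proof
  fix G assume "G \<in> sets Q"
  then show "\<exists>g\<in>borel_measurable R. integrable M g \<and>
        (\<forall>F\<in>sets K. (LINT x:F|M. indicat_real G x) = (LINT x:F|M. g x))"
    using assms by (intro bexI[of _ "\<lambda>_. prob G"] conjI ballI)
      (auto simp: set_lebesgue_integral_def subalgebra_def subset_eq simp flip: indicator_inter_arith)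
qed

end


section \<open>Inverting the lag polynomial\<close>

unbundle no fps_syntax

text \<open>Entry \<open>(l, j)\<close> of the coefficient of L^k in the lag polynomial I - A_0 -
  A_1 L - ... - A_p L^p. It is 0 beyond \<open>p\<close>, so convolutions can run over all
  lags.\<close>

definition lag_coeff :: "nat \<Rightarrow> (nat \<Rightarrow> real^'d^'d::finite) \<Rightarrow> nat \<Rightarrow> 'd \<Rightarrow> 'd \<Rightarrow> real" where
  "lag_coeff p \<Phi> k l j = (if k = 0 \<and> l = j then 1 else 0) - (if k \<le> p then \<Phi> k $ l $ j else 0)"

text \<open>The transpose of the lag polynomial: a row of the inverse then solves an ordinary linear
  system, to which Cramer's rule applies.\<close>

definition lag_matrix :: "nat \<Rightarrow> (nat \<Rightarrow> real^'d^'d::finite) \<Rightarrow> complex \<Rightarrow> complex^'d^'d" where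
  "lag_matrix p \<Phi> w = (\<chi> j l. \<Sum>k\<le>p. of_real (lag_coeff p \<Phi> k l j) * w ^ k)"

text \<open>A cycle would lift to a cycle of the full-time graph inside time slice 0. In this
  orientation the children of a node lie below it, so induction runs upwards from the sinks.\<close>

lemma wf_instantaneous_edges:
  fixes \<Phi> :: "nat \<Rightarrow> real^'d^'d::finite"
  assumes "acyclic (full_time_graph p \<Phi>)"
  shows "wf {(l, j). \<Phi> 0 $ l $ j \<noteq> 0}"
proof (rule finite_acyclic_wf)
  let ?r = "{(l, j). \<Phi> 0 $ l $ j \<noteq> 0}"
  have "((j, 0), (l, 0)) \<in> (full_time_graph p \<Phi>)\<^sup>+" if "(l, j) \<in> ?r\<^sup>+" for l j
    using that
  proof (induction rule: trancl_induct)
    case (base j)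
    then show ?case by (force simp: full_time_graph_def)
  next
    case (step j m)
    then have "((m, 0), (j, 0)) \<in> full_time_graph p \<Phi>" by (force simp: full_time_graph_def)
    then show ?case using step by (metis trancl_into_trancl2)
  qed
  then show "acyclic ?r" using assms by (auto simp: acyclic_def)
qed simp

text \<open>A kernel vector of the transpose of I - A_0 has each entry equal to a weighted sum of
  the entries at its instantaneous children, so it vanishes by induction from the sinks.\<close>

lemma det_lag_matrix_0:
  fixes \<Phi> :: "nat \<Rightarrow> real^'d^'d::finite"
  assumes "acyclic (full_time_graph p \<Phi>)"
  shows "det (lag_matrix p \<Phi> 0) \<noteq> 0"
proof -
  have "x = 0" if x: "lag_matrix p \<Phi> 0 *v x = 0" for x
  proof -
    have eq: "x $ j = (\<Sum>l\<in>UNIV. of_real (\<Phi> 0 $ l $ j) * x $ l)" for j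
    proof -
      have "0 = (lag_matrix p \<Phi> 0 *v x) $ j" using x by simp
      also have "\<dots> = (\<Sum>l\<in>UNIV. of_real (lag_coeff p \<Phi> 0 l j) * x $ l)"
        by (simp add: lag_matrix_def matrix_vector_mult_def power_0_left if_distrib sum.delta cong: if_cong)
      also have "\<dots> = (\<Sum>l\<in>UNIV. (if l = j then x $ l else 0) - of_real (\<Phi> 0 $ l $ j) * x $ l)"
        by (intro sum.cong) (auto simp: lag_coeff_def algebra_simps)
      also have "\<dots> = x $ j - (\<Sum>l\<in>UNIV. of_real (\<Phi> 0 $ l $ j) * x $ l)"
        by (simp add: sum_subtractf)
      finally show ?thesis by simp
    qed
    have "x $ j = 0" for j
      using wf_instantaneous_edges[OF assms]
    proof (induction j rule: wf_induct_rule)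
      case (less j)
      have "(\<Sum>l\<in>UNIV. of_real (\<Phi> 0 $ l $ j) * x $ l) = 0"
        by (intro sum.neutral) (use less in auto)
      then show ?case using eq by metis
    qed
    then show "x = 0" by (simp add: vec_eq_iff)
  qed
  then show ?thesis
    by (simp add: invertible_left_inverse matrix_left_invertible_ker flip: invertible_det_nz)
qed

text \<open>For \<open>w \<noteq> 0\<close> the substitution z = 1/w turns the lag polynomial into
  \<open>char_matrix\<close> up to a nonzero factor, and norm at most 1 becomes norm at least 1. The
  point \<open>w = 0\<close> corresponds to no z; there acyclicity takes over.\<close>

lemma det_lag_matrix:
  fixes \<Phi> :: "nat \<Rightarrow> real^'d^'d::finite"
  assumes ac: "acyclic (full_time_graph p \<Phi>)"
    and root: "\<And>z. det (char_matrix p \<Phi> z) = 0 \<Longrightarrow> norm z < 1"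
    and w: "norm w \<le> 1"
  shows "det (lag_matrix p \<Phi> w) \<noteq> 0"
proof (cases "w = 0")
  case True
  then show ?thesis using det_lag_matrix_0[OF ac] by simp
next
  case False
  have "char_matrix p \<Phi> (1 / w) $ l $ j = (1 / w ^ p) * transpose (lag_matrix p \<Phi> w) $ l $ j" for l j
  proof -
    have "transpose (lag_matrix p \<Phi> w) $ l $ j = (\<Sum>k\<le>p. of_real (lag_coeff p \<Phi> k l j) * w ^ k)"
      by (simp add: lag_matrix_def transpose_def)
    also have "\<dots> = of_real (lag_coeff p \<Phi> 0 l j) + (\<Sum>k=1..p. of_real (lag_coeff p \<Phi> k l j) * w ^ k)"
      by (simp add: atMost_atLeast0 sum.atLeast_Suc_atMost)
    finally have "(1 / w ^ p) * transpose (lag_matrix p \<Phi> w) $ l $ j = of_real (lag_coeff p \<Phi> 0 l j) * (1 / w) ^ p +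
        (\<Sum>k=1..p. of_real (lag_coeff p \<Phi> k l j) * (w ^ k / w ^ p))"
      by (simp add: algebra_simps sum_divide_distrib add_divide_distrib power_divide)
    also have "(\<Sum>k=1..p. of_real (lag_coeff p \<Phi> k l j) * (w ^ k / w ^ p)) =
        (\<Sum>k=1..p. - (of_real (\<Phi> k $ l $ j) * (1 / w) ^ (p - k)))"
      using False by (intro sum.cong) (auto simp: lag_coeff_def power_diff field_simps)
    finally show ?thesis
      by (simp add: char_matrix_def lag_coeff_def mat_def sum_negf)
  qed
  then have "char_matrix p \<Phi> (1 / w) = (\<chi> l. (1 / w ^ p) *s (transpose (lag_matrix p \<Phi> w) $ l))"
    by (simp add: vec_eq_iff)
  then have "det (char_matrix p \<Phi> (1 / w)) = (1 / w ^ p) ^ CARD('d) * det (transpose (lag_matrix p \<Phi> w))"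
    by (simp add: det_rows_mul)
  then show ?thesis using root[of "1 / w"] w False by (auto simp: norm_divide)
qed

lemma holomorphic_on_det:
  fixes g :: "'d::finite \<Rightarrow> 'd \<Rightarrow> complex \<Rightarrow> complex"
  assumes "\<And>j m. g j m holomorphic_on S"
  shows "(\<lambda>w. det (\<chi> j m. g j m w)) holomorphic_on S"
  unfolding det_def using assms by (auto intro!: holomorphic_intros)

lemma lag_matrix_entry_holomorphic [holomorphic_intros]:
  "(\<lambda>w. lag_matrix p \<Phi> w $ j $ m) holomorphic_on S"
  unfolding lag_matrix_def by (auto intro!: holomorphic_intros)

text \<open>The coefficients are the Taylor coefficients of row \<open>i\<close> of the inverse of the lag
  polynomial; they tend to 0 because that inverse is holomorphic on a disc of radius
  larger than 1.\<close>

lemma lag_inverse: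
  fixes \<Phi> :: "nat \<Rightarrow> real^'d^'d::finite" and i :: 'd
  assumes ac: "acyclic (full_time_graph p \<Phi>)"
    and root: "\<And>z. det (char_matrix p \<Phi> z) = 0 \<Longrightarrow> norm z < 1"
  obtains \<psi> :: "nat \<Rightarrow> 'd \<Rightarrow> real"
  where "\<And>j. (\<lambda>n. \<psi> n j) \<longlonglongrightarrow> 0"
    and "\<And>n j. (\<Sum>k\<le>n. \<Sum>l\<in>UNIV. \<psi> (n - k) l * lag_coeff p \<Phi> k l j) = (if n = 0 \<and> j = i then 1 else 0)"
proof -
  define D where "D w = det (lag_matrix p \<Phi> w)" for w
  have holD: "D holomorphic_on S" for S
    unfolding D_def using holomorphic_on_det[of "\<lambda>j m w. lag_matrix p \<Phi> w $ j $ m"]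
    by (simp add: lag_matrix_entry_holomorphic)
  have "open {w. D w \<noteq> 0}"
    using holD[of UNIV] by (intro open_Collect_neq) (auto intro: holomorphic_on_imp_continuous_on)
  moreover have "cball 0 1 \<subseteq> {w. D w \<noteq> 0}"
    using det_lag_matrix[OF ac root] by (auto simp: D_def)
  \<comment> \<open>Compactness of the closed unit disc gives a margin \<open>e\<close> on which the
    determinant stays nonzero.\<close>
  ultimately obtain e where e: "e > 0" "(\<Union>x\<in>cball 0 1. cball x e) \<subseteq> {w. D w \<noteq> 0}"
    using compact_subset_open_imp_cball_epsilon_subset[of "cball 0 (1::real)"] compact_cball by metis
  define R where "R = 1 + e"
  have R: "R > 1" and nz: "D w \<noteq> 0" if "w \<in> ball 0 R" for w
  proof -
    show "R > 1" using e by (simp add: R_def)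
    have "\<exists>x\<in>cball 0 1. w \<in> cball x e"
    proof (cases "norm w \<le> 1")
      case True
      then show ?thesis using e by (intro bexI[of _ w]) auto
    next
      case False
      \<comment> \<open>Outside the unit disc, the radial projection of \<open>w\<close> onto the
        unit circle is a point of the disc within distance \<open>e\<close>.\<close>
      then have "dist (w / of_real (norm w)) w = norm w - 1"
      proof -
        have "w / of_real (norm w) - w = w * of_real (1 / norm w - 1)" by (simp add: algebra_simps)
        then have "dist (w / of_real (norm w)) w = norm w * \<bar>1 / norm w - 1\<bar>"
          by (simp only: dist_norm norm_mult norm_of_real)
        moreover have "1 < norm w" using False by simp
        then have "1 / norm w < 1" by (auto simp: divide_less_eq_1)
        then have "\<bar>1 / norm w - 1\<bar> = 1 - 1 / norm w" by simp
        ultimately show ?thesis using False by (auto simp: right_diff_distrib)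
      qed
      then show ?thesis using that False
        by (intro bexI[of _ "w / of_real (norm w)"]) (auto simp: R_def norm_divide)
    qed
    then show "D w \<noteq> 0" using e by blast
  qed
  have R: "R > 1" using e by (simp add: R_def)
  \<comment> \<open>Cramer's rule with right-hand side \<open>axis i 1\<close>, which replaces
    column \<open>l\<close>.\<close>
  define f where "f l w = det (\<chi> j m. if m = l then axis i 1 $ j else lag_matrix p \<Phi> w $ j $ m) / D w" for l w
  have "(\<lambda>w. if m = l then axis i 1 $ j else lag_matrix p \<Phi> w $ j $ m) holomorphic_on ball 0 R"
    for j m l by (cases "m = l") (simp_all add: lag_matrix_entry_holomorphic)
  then have holf: "f l holomorphic_on ball 0 R" for l
    unfolding f_def using nz
    by (intro holomorphic_on_divide holD holomorphic_on_det) auto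
  have solve: "(\<Sum>l\<in>UNIV. lag_matrix p \<Phi> w $ j $ l * f l w) = (if j = i then 1 else 0)"
    if "w \<in> ball 0 R" for w j
  proof -
    have "lag_matrix p \<Phi> w *v (\<chi> l. f l w) = axis i 1"
      using nz[OF that] by (subst cramer) (auto simp: f_def D_def)
    then have "(lag_matrix p \<Phi> w *v (\<chi> l. f l w)) $ j = axis i 1 $ j" by simp
    then show ?thesis by (simp add: matrix_vector_mult_def axis_def)
  qed
  define F where "F l = fps_expansion (f l) 0" for l
  have F: "f l has_fps_expansion F l" for l
    unfolding F_def using R holf by (intro has_fps_expansion_fps_expansion[of "ball 0 R"]) auto
  define P where "P j l = (\<Sum>k\<le>p. fps_const (of_real (lag_coeff p \<Phi> k l j)) * fps_X ^ k :: complex fps)" for j l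
  have P: "(\<lambda>w. lag_matrix p \<Phi> w $ j $ l) has_fps_expansion P j l" for j l
    unfolding lag_matrix_def P_def by (auto intro!: fps_expansion_intros)
  have P_nth: "fps_nth (P j l) k = of_real (lag_coeff p \<Phi> k l j)" for j l k
  proof -
    have "fps_nth (P j l) k = (\<Sum>m\<le>p. if k = m then of_real (lag_coeff p \<Phi> m l j) else 0)"
      by (simp add: P_def fps_sum_nth fps_X_power_iff if_distrib cong: if_cong)
    also have "\<dots> = of_real (lag_coeff p \<Phi> k l j)" by (auto simp: lag_coeff_def)
    finally show ?thesis .
  qed
  \<comment> \<open>Expansions at 0 are unique, so the linear system solved by \<open>f\<close>
    becomes an identity of formal power series; its coefficients are the required
    convolutions.\<close>
  have "(\<Sum>l\<in>UNIV. P j l * F l) = fps_const (if j = i then 1 else 0)" for j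
  proof (rule fps_expansion_unique_complex)
    show "(\<lambda>w. \<Sum>l\<in>UNIV. lag_matrix p \<Phi> w $ j $ l * f l w) has_fps_expansion (\<Sum>l\<in>UNIV. P j l * F l)"
      by (intro has_fps_expansion_sum has_fps_expansion_mult P F)
    have "eventually (\<lambda>w. w \<in> ball 0 R) (nhds (0::complex))"
      using R by (intro eventually_nhds_in_open) auto
    then have "eventually (\<lambda>w. (if j = i then 1 else 0) = (\<Sum>l\<in>UNIV. lag_matrix p \<Phi> w $ j $ l * f l w)) (nhds 0)"
      by eventually_elim (simp add: solve)
    from has_fps_expansion_cong[OF this refl, THEN iffD1, OF has_fps_expansion_const]
    show "(\<lambda>w. \<Sum>l\<in>UNIV. lag_matrix p \<Phi> w $ j $ l * f l w) has_fps_expansion fps_const (if j = i then 1 else 0)" .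
  qed
  then have nth: "fps_nth (\<Sum>l\<in>UNIV. P j l * F l) n = (if n = 0 \<and> j = i then 1 else 0)" for j n
    by simp
  \<comment> \<open>As every \<open>lag_coeff\<close> is real, the real parts satisfy the same
    convolution identity.\<close>
  define \<psi> where "\<psi> n l = Re (fps_nth (F l) n)" for n l
  have "(\<Sum>k\<le>n. \<Sum>l\<in>UNIV. \<psi> (n - k) l * lag_coeff p \<Phi> k l j) = (if n = 0 \<and> j = i then 1 else 0)" for n j
  proof -
    have "(\<Sum>k\<le>n. \<Sum>l\<in>UNIV. \<psi> (n - k) l * lag_coeff p \<Phi> k l j) = Re (fps_nth (\<Sum>l\<in>UNIV. P j l * F l) n)"
      by (subst sum.swap) (simp add: fps_sum_nth fps_mult_nth P_nth \<psi>_def atMost_atLeast0 mult.commute[of "Re x" for x])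
    then show ?thesis by (simp add: nth)
  qed
  moreover have "(\<lambda>n. \<psi> n l) \<longlonglongrightarrow> 0" for l
  proof -
    have "(\<lambda>n. fps_nth (F l) n * 1 ^ n) sums f l 1"
      using R holf by (intro has_fps_expansion_imp_sums_complex[OF F, where r = R]) auto
    then have "summable (fps_nth (F l))" by (auto simp: sums_iff)
    from tendsto_Re[OF summable_LIMSEQ_zero[OF this]] show ?thesis by (simp add: \<psi>_def)
  qed
  ultimately show thesis using that by blast
qed

text \<open>Solving the convolution identity for \<open>\<psi> n j\<close> shows that a nonzero
  value is either the initial one or inherited from some nonzero \<open>\<psi> (n - k) l\<close>
  through an edge from \<open>(j, t - int n)\<close> to \<open>(l, t - int (n - k))\<close>. The
  induction is lexicographic: on \<open>n\<close>, and for \<open>k = 0\<close> along the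
  instantaneous edges.\<close>

lemma lag_inverse_ancestor:
  fixes \<Phi> :: "nat \<Rightarrow> real^'d^'d::finite"
  assumes ac: "acyclic (full_time_graph p \<Phi>)"
    and inv: "\<And>n j. (\<Sum>k\<le>n. \<Sum>l\<in>UNIV. \<psi> (n - k) l * lag_coeff p \<Phi> k l j) = (if n = 0 \<and> j = i then 1 else 0)"
    and "\<psi> n j \<noteq> 0"
  shows "((j, t - int n), (i, t)) \<in> (full_time_graph p \<Phi>)\<^sup>*"
  using assms(3)
proof (induction n arbitrary: j rule: less_induct)
  case (less n)
  note outer = less.IH
  from wf_instantaneous_edges[OF ac] less.prems show ?case
  proof (induction j rule: wf_induct_rule)
    case (less j)
    define h where "h k l = \<psi> (n - k) l * (if k \<le> p then \<Phi> k $ l $ j else 0)" for k l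
    have "(\<Sum>k\<le>n. \<Sum>l\<in>UNIV. \<psi> (n - k) l * lag_coeff p \<Phi> k l j)
        = (\<Sum>k\<le>n. \<Sum>l\<in>UNIV. (if k = 0 \<and> l = j then \<psi> n j else 0) - h k l)"
      by (intro sum.cong refl) (auto simp: lag_coeff_def h_def algebra_simps)
    also have "\<dots> = (\<Sum>k\<le>n. (if k = 0 then \<psi> n j else 0) - (\<Sum>l\<in>UNIV. h k l))"
      by (intro sum.cong refl) (auto simp: sum_subtractf)
    also have "\<dots> = \<psi> n j - (\<Sum>k\<le>n. \<Sum>l\<in>UNIV. h k l)"
      by (simp add: sum_subtractf)
    finally have eq: "\<psi> n j = (if n = 0 \<and> j = i then 1 else 0) + (\<Sum>k\<le>n. \<Sum>l\<in>UNIV. h k l)"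
      using inv by simp
    have "n = 0 \<and> j = i \<or> (\<exists>k\<le>n. \<exists>l. h k l \<noteq> 0)"
    proof (rule ccontr)
      assume neg: "\<not> ?thesis"
      then have "(\<Sum>k\<le>n. \<Sum>l\<in>UNIV. h k l) = 0" by simp
      moreover have "\<not> (n = 0 \<and> j = i)" using neg by simp
      ultimately have "\<psi> n j = 0" using eq by (simp only: if_False)
      then show False using less.prems by simp
    qed
    then show ?case
    proof
      assume "n = 0 \<and> j = i"
      then show ?thesis by simp
    next
      assume "\<exists>k\<le>n. \<exists>l. h k l \<noteq> 0"
      then obtain k l where kl: "k \<le> n" "k \<le> p" "\<psi> (n - k) l \<noteq> 0" "\<Phi> k $ l $ j \<noteq> 0"
        by (auto simp: h_def split: if_splits)
      have "((j, t - int n), (l, t - int (n - k))) \<in> full_time_graph p \<Phi>"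
        unfolding full_time_graph_def using kl
        by (auto intro!: exI[of _ k] exI[of _ "t - int (n - k)"])
      moreover have "((l, t - int (n - k)), (i, t)) \<in> (full_time_graph p \<Phi>)\<^sup>*"
      proof (cases "k = 0")
        case True
        then show ?thesis using less.IH[of l] kl by auto
      next
        case False
        then show ?thesis using outer[of "n - k" l] kl by auto
      qed
      ultimately show ?thesis by (rule converse_rtrancl_into_rtrancl)
    qed
  qed
qed


section \<open>Almost sure versions and convergence in probability\<close>

context prob_space
begin

lemma indep_vars_cong_AE:
  assumes X: "indep_vars M' X I" and Y: "\<And>i. i \<in> I \<Longrightarrow> Y i \<in> M \<rightarrow>\<^sub>M M' i"
    and eq: "\<And>i. i \<in> I \<Longrightarrow> AE \<omega> in M. X i \<omega> = Y i \<omega>"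
  shows "indep_vars M' Y I"
  unfolding indep_vars_def2
proof (intro conjI ballI Y indep_setsI)
  fix A J assume J: "J \<noteq> {}" "J \<subseteq> I" "finite J"
    and "\<forall>j\<in>J. A j \<in> {Y j -` B \<inter> space M |B. B \<in> sets (M' j)}"
  then obtain B where B: "\<And>j. j \<in> J \<Longrightarrow> A j = Y j -` B j \<inter> space M \<and> B j \<in> sets (M' j)"
    by (simp only: mem_Collect_eq) metis
  have Xm: "X j \<in> M \<rightarrow>\<^sub>M M' j" if "j \<in> I" for j using X that by (auto simp: indep_vars_def2)
  have XB: "X j -` B j \<inter> space M \<in> events" "A j \<in> events" if "j \<in> J" for j
    using B[OF that] Xm Y that J by (auto intro: measurable_sets)
  have ae: "AE \<omega> in M. \<forall>j\<in>J. X j \<omega> = Y j \<omega>"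
    using J eq by (intro AE_finite_allI) auto
  have "prob (\<Inter>j\<in>J. A j) = prob (\<Inter>j\<in>J. X j -` B j \<inter> space M)"
    using ae J B XB by (intro finite_measure_eq_AE sets.finite_INT) auto
  also have "\<dots> = (\<Prod>j\<in>J. prob (X j -` B j \<inter> space M))"
    using J B by (intro indep_varsD[OF X]) auto
  also have "\<dots> = (\<Prod>j\<in>J. prob (A j))"
    using ae J B XB by (intro prod.cong finite_measure_eq_AE) auto
  finally show "prob (\<Inter>j\<in>J. A j) = (\<Prod>j\<in>J. prob (A j))" .
next
  show "{Y i -` B \<inter> space M |B. B \<in> sets (M' i)} \<subseteq> events" if "i \<in> I" for i
    using measurable_sets[OF Y[OF that]] by blast
qed

text \<open>Almost sure equality with a noise functional does not make a variable measurable for the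
  noise itself; it does make it measurable for this enlargement, which preserves
  independence.\<close>

definition ae_algebra :: "'a measure \<Rightarrow> 'a measure" where
  "ae_algebra G = sigma (space M) {F \<in> events. \<exists>F'\<in>sets G. AE \<omega> in M. \<omega> \<in> F \<longleftrightarrow> \<omega> \<in> F'}"

lemma space_ae_algebra [simp]: "space (ae_algebra G) = space M"
  by (simp add: ae_algebra_def space_measure_of_conv)

lemma sets_ae_algebra:
  assumes "subalgebra M G"
  shows "sets (ae_algebra G) = {F \<in> events. \<exists>F'\<in>sets G. AE \<omega> in M. \<omega> \<in> F \<longleftrightarrow> \<omega> \<in> F'}" (is "_ = ?S")
proof -
  have "sigma_algebra (space M) ?S"
    unfolding sigma_algebra_iff2
  proof (intro conjI ballI allI impI)
    show "?S \<subseteq> Pow (space M)" using sets.sets_into_space by auto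
    show "{} \<in> ?S" by auto
  next
    fix F assume "F \<in> ?S"
    then obtain F' where F': "F \<in> events" "F' \<in> sets G" "AE \<omega> in M. \<omega> \<in> F \<longleftrightarrow> \<omega> \<in> F'" by auto
    have "AE \<omega> in M. \<omega> \<in> space M - F \<longleftrightarrow> \<omega> \<in> space G - F'"
      using F'(3) by eventually_elim (use assms in \<open>auto simp: subalgebra_def\<close>)
    then show "space M - F \<in> ?S" using F' by blast
  next
    fix F :: "nat \<Rightarrow> 'a set" assume "range F \<subseteq> ?S"
    then have "\<forall>n. F n \<in> events \<and> (\<exists>F'\<in>sets G. AE \<omega> in M. \<omega> \<in> F n \<longleftrightarrow> \<omega> \<in> F')" by blast
    then obtain F' where F': "\<And>n. F n \<in> events" "\<And>n. F' n \<in> sets G"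
        "\<And>n. AE \<omega> in M. \<omega> \<in> F n \<longleftrightarrow> \<omega> \<in> F' n" by metis
    have "AE \<omega> in M. \<forall>n. \<omega> \<in> F n \<longleftrightarrow> \<omega> \<in> F' n" using F' by (simp add: AE_all_countable)
    then have "AE \<omega> in M. \<omega> \<in> (\<Union>n. F n) \<longleftrightarrow> \<omega> \<in> (\<Union>n. F' n)" by eventually_elim auto
    moreover have "(\<Union>n. F n) \<in> events" "(\<Union>n. F' n) \<in> sets G" using F' by auto
    ultimately show "(\<Union>n. F n) \<in> ?S" by blast
  qed
  from sigma_algebra.sets_measure_of_eq[OF this] show ?thesis
    unfolding ae_algebra_def .
qed

lemma borel_measurable_ae_algebra:
  assumes "subalgebra M G" and "Y \<in> borel_measurable G" and X: "X \<in> borel_measurable M"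
    and eq: "AE \<omega> in M. X \<omega> = Y \<omega>"
  shows "X \<in> borel_measurable (ae_algebra G)"
proof (rule measurableI)
  fix D :: "'b set" assume D: "D \<in> sets borel"
  have "X -` D \<inter> space M \<in> events" "Y -` D \<inter> space G \<in> sets G"
    using D assms by (auto intro: measurable_sets)
  moreover have "AE \<omega> in M. \<omega> \<in> X -` D \<inter> space M \<longleftrightarrow> \<omega> \<in> Y -` D \<inter> space G"
    using eq AE_space by eventually_elim (use assms in \<open>auto simp: subalgebra_def\<close>)
  ultimately show "X -` D \<inter> space (ae_algebra G) \<in> sets (ae_algebra G)"
    unfolding sets_ae_algebra[OF assms(1)] space_ae_algebra by blast
qed simp

lemma indep_ae_algebra:
  assumes sub: "subalgebra M G" "subalgebra M H"
    and ind: "\<And>F F'. F \<in> sets G \<Longrightarrow> F' \<in> sets H \<Longrightarrow> prob (F \<inter> F') = prob F * prob F'"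
    and F: "F \<in> sets (ae_algebra G)" "F' \<in> sets (ae_algebra H)"
  shows "prob (F \<inter> F') = prob F * prob F'"
proof -
  obtain D where D: "D \<in> sets G" "AE \<omega> in M. \<omega> \<in> F \<longleftrightarrow> \<omega> \<in> D" "F \<in> events"
    using F(1) by (auto simp: sets_ae_algebra[OF sub(1)])
  obtain D' where D': "D' \<in> sets H" "AE \<omega> in M. \<omega> \<in> F' \<longleftrightarrow> \<omega> \<in> D'" "F' \<in> events"
    using F(2) by (auto simp: sets_ae_algebra[OF sub(2)])
  have ev: "D \<in> events" "D' \<in> events" using D D' sub by (auto simp: subalgebra_def)
  have "AE \<omega> in M. \<omega> \<in> F \<inter> F' \<longleftrightarrow> \<omega> \<in> D \<inter> D'" using D(2) D'(2) by eventually_elim auto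
  then have "prob (F \<inter> F') = prob (D \<inter> D')" using D D' ev by (intro finite_measure_eq_AE) auto
  also have "\<dots> = prob D * prob D'" using ind D D' by blast
  also have "\<dots> = prob F * prob F'"
    using finite_measure_eq_AE[OF D(2,3) ev(1)] finite_measure_eq_AE[OF D'(2,3) ev(2)] by simp
  finally show ?thesis .
qed

lemma indep_sigma_gen:
  assumes N: "indep_vars (\<lambda>_. borel) N UNIV" and "V \<inter> W = {}"
    and "F \<in> sets (sigma_gen M N V)" "G \<in> sets (sigma_gen M N W)"
  shows "prob (F \<inter> G) = prob F * prob G"
  using indep_var_restrict[OF N assms(2)] assms(3,4)
  by (auto simp: indep_var_eq indep_sets2_eq sigma_gen_def sets_vimage_algebra)

text \<open>Convergence to 0 in probability, expressed through the bounded metric E min(1, |Z|),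
  which is finite for every random variable.\<close>

definition small_seq :: "(nat \<Rightarrow> 'a \<Rightarrow> real) \<Rightarrow> bool" where
  "small_seq Z \<longleftrightarrow> (\<forall>n. Z n \<in> borel_measurable M) \<and> (\<lambda>n. \<integral>\<omega>. min 1 \<bar>Z n \<omega>\<bar> \<partial>M) \<longlonglongrightarrow> 0"

lemma integrable_min_1:
  fixes X :: "'a \<Rightarrow> real"
  shows "X \<in> borel_measurable M \<Longrightarrow> integrable M (\<lambda>\<omega>. min 1 \<bar>X \<omega>\<bar>)"
  by (rule integrable_const_bound[where B = 1]) auto

lemma small_seq_add:
  assumes "small_seq Z" and "small_seq Z'"
  shows "small_seq (\<lambda>n \<omega>. Z n \<omega> + Z' n \<omega>)"
proof -
  have m: "\<And>n. Z n \<in> borel_measurable M" "\<And>n. Z' n \<in> borel_measurable M"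
    using assms by (auto simp: small_seq_def)
  have "(\<lambda>n. \<integral>\<omega>. min 1 \<bar>Z n \<omega> + Z' n \<omega>\<bar> \<partial>M) \<longlonglongrightarrow> 0"
  proof (rule tendsto_sandwich)
    show "\<forall>\<^sub>F n in sequentially. 0 \<le> (\<integral>\<omega>. min 1 \<bar>Z n \<omega> + Z' n \<omega>\<bar> \<partial>M)" by simp
    have "(\<integral>\<omega>. min 1 \<bar>Z n \<omega> + Z' n \<omega>\<bar> \<partial>M) \<le> (\<integral>\<omega>. min 1 \<bar>Z n \<omega>\<bar> + min 1 \<bar>Z' n \<omega>\<bar> \<partial>M)" for n
      using m by (intro integral_mono integrable_min_1 Bochner_Integration.integrable_add)
        (auto simp: min_def)
    also have "(\<integral>\<omega>. min 1 \<bar>Z n \<omega>\<bar> + min 1 \<bar>Z' n \<omega>\<bar> \<partial>M) =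
        (\<integral>\<omega>. min 1 \<bar>Z n \<omega>\<bar> \<partial>M) + (\<integral>\<omega>. min 1 \<bar>Z' n \<omega>\<bar> \<partial>M)" for n
      using m by (intro Bochner_Integration.integral_add integrable_min_1) auto
    finally show "\<forall>\<^sub>F n in sequentially. (\<integral>\<omega>. min 1 \<bar>Z n \<omega> + Z' n \<omega>\<bar> \<partial>M) \<le>
        (\<integral>\<omega>. min 1 \<bar>Z n \<omega>\<bar> \<partial>M) + (\<integral>\<omega>. min 1 \<bar>Z' n \<omega>\<bar> \<partial>M)" by simp
    show "(\<lambda>n. (\<integral>\<omega>. min 1 \<bar>Z n \<omega>\<bar> \<partial>M) + (\<integral>\<omega>. min 1 \<bar>Z' n \<omega>\<bar> \<partial>M)) \<longlonglongrightarrow> 0"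
      using tendsto_add[of _ 0 _ _ 0] assms by (auto simp: small_seq_def)
  qed simp
  then show ?thesis using m by (auto simp: small_seq_def)
qed

lemma small_seq_sum:
  assumes "\<And>x. x \<in> T \<Longrightarrow> small_seq (Z x)"
  shows "small_seq (\<lambda>n \<omega>. \<Sum>x\<in>T. Z x n \<omega>)"
  using assms
proof (induction T rule: infinite_finite_induct)
  case (insert x T)
  then show ?case by (simp add: small_seq_add)
qed (simp_all add: small_seq_def)

text \<open>As all \<open>X n\<close> have one law, the expectation is unchanged when
  \<open>X n\<close> is replaced by the fixed variable \<open>X 0\<close>; dominated convergence
  then applies.\<close>

lemma small_seq_mult:
  assumes c: "c \<longlonglongrightarrow> 0" and X: "\<And>n. X n \<in> borel_measurable M"
    and D: "\<And>n. distr M borel (X n) = D"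
  shows "small_seq (\<lambda>n \<omega>. c n * X n \<omega>)"
proof -
  have "(\<integral>\<omega>. min 1 \<bar>c n * X n \<omega>\<bar> \<partial>M) = (\<integral>\<omega>. min 1 \<bar>c n * X 0 \<omega>\<bar> \<partial>M)" for n
  proof -
    have "(\<integral>\<omega>. min 1 \<bar>c n * X k \<omega>\<bar> \<partial>M) = (\<integral>x. min 1 \<bar>c n * x\<bar> \<partial>D)" for k
      using D[of k, symmetric] X by (simp add: integral_distr)
    then show ?thesis by simp
  qed
  moreover have "(\<lambda>n. \<integral>\<omega>. min 1 \<bar>c n * X 0 \<omega>\<bar> \<partial>M) \<longlonglongrightarrow> (\<integral>\<omega>. 0 \<partial>M)"
  proof (rule integral_dominated_convergence[where w = "\<lambda>_. 1"])
    have "(\<lambda>n. min 1 \<bar>c n * X 0 \<omega>\<bar>) \<longlonglongrightarrow> min 1 \<bar>0 * X 0 \<omega>\<bar>" for \<omega>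
      by (intro tendsto_intros c)
    then show "AE \<omega> in M. (\<lambda>n. min 1 \<bar>c n * X 0 \<omega>\<bar>) \<longlonglongrightarrow> 0" by simp
  qed (use X in auto)
  ultimately show ?thesis using X by (simp add: small_seq_def)
qed

lemma small_seq_AE_subseq:
  assumes "small_seq Z"
  obtains r :: "nat \<Rightarrow> nat" where "strict_mono r" "AE \<omega> in M. (\<lambda>n. Z (r n) \<omega>) \<longlonglongrightarrow> 0"
proof -
  obtain r where r: "strict_mono r" "AE \<omega> in M. (\<lambda>n. min 1 \<bar>Z (r n) \<omega>\<bar>) \<longlonglongrightarrow> 0"
    using tendsto_L1_AE_subseq[of M "\<lambda>n \<omega>. min 1 \<bar>Z n \<omega>\<bar>"] assms integrable_min_1
    by (auto simp: small_seq_def)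
  have "AE \<omega> in M. (\<lambda>n. Z (r n) \<omega>) \<longlonglongrightarrow> 0"
    using r(2)
  proof eventually_elim
    case (elim \<omega>)
    \<comment> \<open>Below 1 the truncation is inactive, so convergence of the truncated values
      gives that of the values themselves.\<close>
    have "eventually (\<lambda>n. min 1 \<bar>Z (r n) \<omega>\<bar> < 1) sequentially"
      using elim by (rule order_tendstoD) simp
    then have "eventually (\<lambda>n. min 1 \<bar>Z (r n) \<omega>\<bar> = \<bar>Z (r n) \<omega>\<bar>) sequentially"
      by eventually_elim auto
    with elim have "(\<lambda>n. \<bar>Z (r n) \<omega>\<bar>) \<longlonglongrightarrow> 0" using tendsto_cong by fast
    then show ?case by (simp add: tendsto_rabs_zero_iff)
  qed
  with r(1) that show thesis by blast
qed

end


section \<open>The global Markov property\<close>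

lemma closed_imp_ancestors:
  assumes "\<And>x y. (x, y) \<in> E \<Longrightarrow> y \<in> V \<Longrightarrow> x \<in> V"
  shows "ancestors E V = V"
proof -
  have "x \<in> V" if "(x, y) \<in> E\<^sup>*" "y \<in> V" for x y
    using that by (induction rule: converse_rtrancl_induct) (auto intro: assms)
  then show ?thesis by (auto simp: ancestors_def)
qed

lemma finite_acyclic_sink:
  assumes "acyclic E" and "finite F" and "F \<noteq> {}"
  obtains v where "v \<in> F" "\<And>u. u \<in> F \<Longrightarrow> (v, u) \<notin> E"
proof -
  have "wf ((E \<inter> F \<times> F)\<inverse>)"
    using assms by (intro finite_acyclic_wf_converse) (auto intro: acyclic_subset)
  from wfE_min'[OF this assms(3)] obtain v where
    "v \<in> F" "\<And>u. (u, v) \<in> (E \<inter> F \<times> F)\<inverse> \<Longrightarrow> u \<notin> F" by metis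
  then show thesis using that by blast
qed

locale VAR = prob_space M for M :: "'w measure" +
  fixes p :: nat and \<Phi> :: "nat \<Rightarrow> real^'d^'d::finite" and \<epsilon> S :: "int \<Rightarrow> 'w \<Rightarrow> real^'d"
  assumes var: "VAR_process M p \<Phi> \<epsilon> S" and ac: "acyclic (full_time_graph p \<Phi>)"
begin

abbreviation "E \<equiv> full_time_graph p \<Phi>"
abbreviation "X \<equiv> node_var S"

text \<open>The innovations are recovered from \<open>S\<close> so that the structural equations hold
  everywhere and not just almost surely.\<close>

definition N :: "'d \<times> int \<Rightarrow> 'w \<Rightarrow> real" where
  "N v \<omega> = (\<Sum>k\<le>p. \<Sum>j\<in>UNIV. lag_coeff p \<Phi> k (fst v) j * X (j, snd v - int k) \<omega>)"

lemma measurable_nth: "(\<lambda>x::real^'d. x $ i) \<in> borel_measurable borel"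
  by (intro borel_measurable_continuous_onI continuous_intros)

lemma S_measurable: "S t \<in> borel_measurable M"
  using var by (simp add: VAR_process_def)

lemma X_measurable [measurable]: "X v \<in> borel_measurable M"
  unfolding node_var_def[abs_def] using measurable_compose[OF S_measurable measurable_nth] .

lemma N_measurable [measurable]: "N v \<in> borel_measurable M"
  unfolding N_def[abs_def] by measurable

lemma structural_equation:
  "X (i, t) \<omega> = N (i, t) \<omega> + (\<Sum>k\<le>p. \<Sum>j\<in>UNIV. \<Phi> k $ i $ j * X (j, t - int k) \<omega>)"
proof -
  have "N (i, t) \<omega> = (\<Sum>k\<le>p. \<Sum>j\<in>UNIV. (if k = 0 \<and> j = i then X (i, t) \<omega> else 0) - \<Phi> k $ i $ j * X (j, t - int k) \<omega>)"
    unfolding N_def by (intro sum.cong refl) (auto simp: lag_coeff_def algebra_simps)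
  also have "\<dots> = (\<Sum>k\<le>p. (if k = 0 then X (i, t) \<omega> else 0) - (\<Sum>j\<in>UNIV. \<Phi> k $ i $ j * X (j, t - int k) \<omega>))"
    by (intro sum.cong refl) (auto simp: sum_subtractf)
  also have "\<dots> = X (i, t) \<omega> - (\<Sum>k\<le>p. \<Sum>j\<in>UNIV. \<Phi> k $ i $ j * X (j, t - int k) \<omega>)"
    by (simp add: sum_subtractf)
  finally show ?thesis by simp
qed

lemma N_AE_eq: "AE \<omega> in M. \<epsilon> (snd v) \<omega> $ fst v = N v \<omega>"
proof -
  obtain i t where v: "v = (i, t)" by (cases v)
  have "AE \<omega> in M. S t \<omega> = (\<Sum>k\<le>p. \<Phi> k *v S (t - int k) \<omega>) + \<epsilon> t \<omega>"
    using var by (simp add: VAR_process_def)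
  then show ?thesis
  proof eventually_elim
    case (elim \<omega>)
    have "X (i, t) \<omega> = ((\<Sum>k\<le>p. \<Phi> k *v S (t - int k) \<omega>) + \<epsilon> t \<omega>) $ i"
      using elim by (simp add: node_var_def)
    also have "\<dots> = (\<Sum>k\<le>p. \<Sum>j\<in>UNIV. \<Phi> k $ i $ j * X (j, t - int k) \<omega>) + \<epsilon> t \<omega> $ i"
      by (simp add: matrix_vector_mult_def node_var_def)
    finally show ?case using structural_equation[of i t \<omega>] v by simp
  qed
qed

text \<open>Independence over time and independence of the components at each time combine: an event
  on finitely many nodes is an intersection of box events, one for each time, and each box factors
  over its components.\<close>

lemma indep_vars_noise_components: "indep_vars (\<lambda>_. borel) (\<lambda>v \<omega>. \<epsilon> (snd v) \<omega> $ fst v) UNIV"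
proof -
  define e where "e v \<omega> = \<epsilon> (snd v) \<omega> $ fst v" for v \<omega>
  have it: "indep_vars (\<lambda>_. borel) \<epsilon> UNIV"
    and ic: "\<And>t. indep_vars (\<lambda>_. borel) (\<lambda>i \<omega>. \<epsilon> t \<omega> $ i) UNIV"
    using var by (auto simp: VAR_process_def iid_noise_def)
  have [measurable]: "\<epsilon> t \<in> borel_measurable M" for t
    using it by (auto simp: indep_vars_def2)
  have e_meas: "e v \<in> borel_measurable M" for v
    unfolding e_def using measurable_compose[OF _ measurable_nth] by measurable
  have "indep_vars (\<lambda>_. borel) e UNIV"
    unfolding indep_vars_def2
  proof (intro conjI ballI indep_setsI)
    show "e v \<in> borel_measurable M" for v by (rule e_meas)
    show "{e v -` A \<inter> space M |A. A \<in> sets borel} \<subseteq> events" for v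
      using measurable_sets[OF e_meas] by blast
  next
    fix A and J :: "('d \<times> int) set" assume J: "J \<noteq> {}" "finite J"
      and "\<forall>v\<in>J. A v \<in> {e v -` B \<inter> space M |B. B \<in> sets borel}"
    then obtain B where B: "\<And>v. v \<in> J \<Longrightarrow> A v = e v -` B v \<inter> space M \<and> B v \<in> sets borel"
      by (simp only: mem_Collect_eq) metis
    \<comment> \<open>Padding with \<open>UNIV\<close> completes \<open>J\<close> to full time
      slices; the added factors are 1 and are dropped again at the end.\<close>
    define B' where "B' v = (if v \<in> J then B v else UNIV)" for v
    define T where "T = snd ` J"
    define C where "C t = {x::real^'d. \<forall>i. x $ i \<in> B' (i, t)}" for t
    have B': "B' v \<in> sets borel" for v using B by (auto simp: B'_def)
    have C: "C t \<in> sets borel" for t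
    proof -
      have "C t = (\<Inter>i\<in>UNIV. (\<lambda>x::real^'d. x $ i) -` B' (i, t) \<inter> space borel)"
        by (auto simp: C_def)
      also have "\<dots> \<in> sets borel"
        using measurable_sets[OF measurable_nth B'] by (intro sets.finite_INT) auto
      finally show ?thesis .
    qed
    have T: "finite T" "T \<noteq> {}" "J \<subseteq> UNIV \<times> T" using J by (auto simp: T_def intro: rev_image_eqI)
    have "(\<Inter>v\<in>J. A v) = (\<Inter>t\<in>T. \<epsilon> t -` C t \<inter> space M)"
    proof (intro set_eqI iffI)
      fix \<omega> assume w: "\<omega> \<in> (\<Inter>v\<in>J. A v)"
      then have "\<omega> \<in> space M" using J B by auto
      moreover have "\<epsilon> t \<omega> $ i \<in> B' (i, t)" for i t
        using w B[of "(i, t)"] by (auto simp: B'_def e_def)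
      ultimately show "\<omega> \<in> (\<Inter>t\<in>T. \<epsilon> t -` C t \<inter> space M)" by (auto simp: C_def)
    next
      fix \<omega> assume w: "\<omega> \<in> (\<Inter>t\<in>T. \<epsilon> t -` C t \<inter> space M)"
      show "\<omega> \<in> (\<Inter>v\<in>J. A v)"
      proof
        fix v assume v: "v \<in> J"
        then have "snd v \<in> T" by (auto simp: T_def)
        from INT_D[OF w this] have "\<omega> \<in> space M" "\<epsilon> (snd v) \<omega> \<in> C (snd v)" by auto
        then have "\<epsilon> (snd v) \<omega> $ fst v \<in> B' v" unfolding C_def
          by (metis (mono_tags, lifting) mem_Collect_eq prod.collapse)
        then show "\<omega> \<in> A v" using B[OF v] v \<open>\<omega> \<in> space M\<close> by (auto simp: e_def B'_def)
      qed
    qed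
    then have "prob (\<Inter>v\<in>J. A v) = prob (\<Inter>t\<in>T. \<epsilon> t -` C t \<inter> space M)" by simp
    also have "\<dots> = (\<Prod>t\<in>T. prob (\<epsilon> t -` C t \<inter> space M))"
      using T C by (intro indep_varsD[OF it]) auto
    also have "\<dots> = (\<Prod>t\<in>T. \<Prod>i\<in>UNIV. prob (e (i, t) -` B' (i, t) \<inter> space M))"
    proof (intro prod.cong refl)
      fix t
      have "\<epsilon> t -` C t \<inter> space M = (\<Inter>i\<in>UNIV. (\<lambda>\<omega>. \<epsilon> t \<omega> $ i) -` B' (i, t) \<inter> space M)"
        by (auto simp: C_def)
      also have "prob \<dots> = (\<Prod>i\<in>UNIV. prob ((\<lambda>\<omega>. \<epsilon> t \<omega> $ i) -` B' (i, t) \<inter> space M))"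
        using B' by (intro indep_varsD[OF ic]) auto
      finally show "prob (\<epsilon> t -` C t \<inter> space M) = (\<Prod>i\<in>UNIV. prob (e (i, t) -` B' (i, t) \<inter> space M))"
        by (simp add: e_def[abs_def])
    qed
    also have "\<dots> = (\<Prod>(t, i)\<in>T \<times> UNIV. prob (e (i, t) -` B' (i, t) \<inter> space M))"
      by (simp add: prod.cartesian_product)
    also have "\<dots> = (\<Prod>v\<in>UNIV \<times> T. prob (e v -` B' v \<inter> space M))"
      by (rule prod.reindex_bij_witness[of _ prod.swap prod.swap]) auto
    also have "\<dots> = (\<Prod>v\<in>J. prob (e v -` B' v \<inter> space M))"
      using T by (intro prod.mono_neutral_right) (auto simp: B'_def prob_space)
    also have "\<dots> = (\<Prod>v\<in>J. prob (A v))"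
      using B by (intro prod.cong) (auto simp: B'_def)
    finally show "prob (\<Inter>v\<in>J. A v) = (\<Prod>v\<in>J. prob (A v))" .
  qed
  then show ?thesis by (simp add: e_def[abs_def])
qed

lemma indep_vars_N: "indep_vars (\<lambda>_. borel) N UNIV"
  by (rule indep_vars_cong_AE[OF indep_vars_noise_components]) (simp_all add: N_AE_eq)

lemma distr_X: "distr M borel (X (j, s)) = distr M borel (X (j, 0))"
proof -
  let ?P = "\<Pi>\<^sub>M (t::int)\<in>UNIV. (borel :: (real^'d) measure)"
  have m: "(\<lambda>\<omega> t. S (t + h) \<omega>) \<in> M \<rightarrow>\<^sub>M ?P" for h
    by (rule measurable_PiM_single') (auto simp: S_measurable)
  have "(\<lambda>x. x 0) \<in> ?P \<rightarrow>\<^sub>M borel" by (rule measurable_component_singleton) simp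
  from measurable_compose[OF this measurable_nth]
  have m': "(\<lambda>x. x 0 $ j) \<in> ?P \<rightarrow>\<^sub>M borel" .
  have "distr M borel (X (j, h)) = distr (distr M ?P (\<lambda>\<omega> t. S (t + h) \<omega>)) borel (\<lambda>x. x 0 $ j)" for h
    by (simp add: distr_distr[OF m' m] o_def node_var_def[abs_def])
  moreover have "distr M ?P (\<lambda>\<omega> t. S (t + s) \<omega>) = distr M ?P (\<lambda>\<omega> t. S (t + 0) \<omega>)"
    using var by (simp add: VAR_process_def strictly_stationary_def)
  ultimately show ?thesis by metis
qed

text \<open>Composing the lag polynomial with a truncation of its inverse leaves, besides \<open>X (i, t)\<close>,
  only boundary terms whose coefficients tend to 0; by stationarity they vanish in
  probability, without any moment assumption on \<open>S\<close>.\<close>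

lemma truncated_inverse:
  assumes inv: "\<And>n j. (\<Sum>k\<le>n. \<Sum>l\<in>UNIV. \<psi> (n - k) l * lag_coeff p \<Phi> k l j) = (if n = 0 \<and> j = i then 1 else 0)"
    and n: "p < n"
  shows "(\<Sum>m<n. \<Sum>l\<in>UNIV. \<psi> m l * N (l, t - int m) \<omega>) = X (i, t) \<omega> +
    (\<Sum>k\<le>p. \<Sum>r\<in>{1..k}. \<Sum>j\<in>UNIV. (\<Sum>l\<in>UNIV. \<psi> (n - r) l * lag_coeff p \<Phi> k l j) * X (j, t - int (n - r + k)) \<omega>)"
proof -
  define G where "G k m = (\<Sum>j\<in>UNIV. (\<Sum>l\<in>UNIV. \<psi> m l * lag_coeff p \<Phi> k l j) * X (j, t - int (m + k)) \<omega>)" for k m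
  have G0: "G k m = 0" if "p < k" for k m using that by (simp add: G_def lag_coeff_def)
  have "(\<Sum>l\<in>UNIV. \<psi> m l * N (l, t - int m) \<omega>) = (\<Sum>k\<le>p. G k m)" for m
  proof -
    have "(\<Sum>l\<in>UNIV. \<psi> m l * N (l, t - int m) \<omega>) =
       (\<Sum>l\<in>UNIV. \<Sum>k\<le>p. \<Sum>j\<in>UNIV. \<psi> m l * lag_coeff p \<Phi> k l j * X (j, t - int (m + k)) \<omega>)"
      by (simp add: N_def sum_distrib_left algebra_simps)
    also have "\<dots> = (\<Sum>k\<le>p. \<Sum>l\<in>UNIV. \<Sum>j\<in>UNIV. \<psi> m l * lag_coeff p \<Phi> k l j * X (j, t - int (m + k)) \<omega>)"
      by (rule sum.swap)
    also have "\<dots> = (\<Sum>k\<le>p. G k m)"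
      unfolding G_def sum_distrib_right by (intro sum.cong refl sum.swap)
    finally show ?thesis .
  qed
  then have "(\<Sum>m<n. \<Sum>l\<in>UNIV. \<psi> m l * N (l, t - int m) \<omega>) = (\<Sum>k\<le>p. \<Sum>m<n. G k m)"
    by (simp add: sum.swap[of _ "{..p}"])
  \<comment> \<open>Terms of total lag \<open>k + m < n\<close> form complete convolutions. Those
    with \<open>m = n - r\<close> and \<open>1 \<le> r \<le> k\<close> have total lag at least
    \<open>n\<close> and make up the boundary.\<close>
  also have "\<dots> = (\<Sum>k\<le>p. (\<Sum>m<n - k. G k m) + (\<Sum>r\<in>{1..k}. G k (n - r)))"
  proof (intro sum.cong refl)
    fix k assume "k \<in> {..p}"
    then have k: "k \<le> n" using n by auto
    have "(\<Sum>m<n. G k m) = (\<Sum>m\<in>{..<n - k} \<union> {n - k..<n}. G k m)"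
      using k by (intro sum.cong) auto
    also have "\<dots> = (\<Sum>m<n - k. G k m) + (\<Sum>m\<in>{n - k..<n}. G k m)"
      by (intro sum.union_disjoint) auto
    also have "(\<Sum>m\<in>{n - k..<n}. G k m) = (\<Sum>r\<in>{1..k}. G k (n - r))"
      using k by (intro sum.reindex_bij_witness[of _ "\<lambda>r. n - r" "\<lambda>m. n - m"]) auto
    finally show "(\<Sum>m<n. G k m) = (\<Sum>m<n - k. G k m) + (\<Sum>r\<in>{1..k}. G k (n - r))" .
  qed
  also have "\<dots> = (\<Sum>k\<le>p. \<Sum>m<n - k. G k m) + (\<Sum>k\<le>p. \<Sum>r\<in>{1..k}. G k (n - r))"
    by (rule sum.distrib)
  also have "(\<Sum>k\<le>p. \<Sum>m<n - k. G k m) = (\<Sum>k<n. \<Sum>m<n - k. G k m)"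
    using n by (intro sum.mono_neutral_left) (auto simp: G0)
  also have "\<dots> = (\<Sum>(k, m)\<in>{(k, m). k + m < n}. G k m)"
  proof -
    have "{(k, m). k + m < n} = Sigma {..<n} (\<lambda>k. {..<n - k})" by auto
    then show ?thesis by (simp add: sum.Sigma)
  qed
  \<comment> \<open>For fixed total lag \<open>u = k + m\<close> all terms multiply the same
    \<open>X (j, t - int u)\<close>, so the sum over \<open>k\<close> is the convolution in
    \<open>inv\<close>, and only \<open>u = 0\<close> survives.\<close>
  also have "\<dots> = (\<Sum>u<n. \<Sum>k\<le>u. G k (u - k))" by (rule sum.triangle_reindex)
  also have "\<dots> = (\<Sum>u<n. if u = 0 then X (i, t) \<omega> else 0)"
  proof (intro sum.cong refl)
    fix u
    have "(\<Sum>k\<le>u. G k (u - k)) = (\<Sum>k\<le>u. \<Sum>j\<in>UNIV. (\<Sum>l\<in>UNIV. \<psi> (u - k) l * lag_coeff p \<Phi> k l j) * X (j, t - int u) \<omega>)"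
      unfolding G_def by (intro sum.cong refl) auto
    also have "\<dots> = (\<Sum>j\<in>UNIV. (\<Sum>k\<le>u. \<Sum>l\<in>UNIV. \<psi> (u - k) l * lag_coeff p \<Phi> k l j) * X (j, t - int u) \<omega>)"
      by (subst sum.swap) (simp add: sum_distrib_right)
    also have "\<dots> = (\<Sum>j\<in>UNIV. if j = i then (if u = 0 then X (i, t) \<omega> else 0) else 0)"
      unfolding inv by (intro sum.cong) auto
    finally show "(\<Sum>k\<le>u. G k (u - k)) = (if u = 0 then X (i, t) \<omega> else 0)" by simp
  qed
  also have "\<dots> = X (i, t) \<omega>" using n by simp
  finally show ?thesis by (simp add: G_def)
qed

text \<open>The truncated inverses involve only noise at ancestors of \<open>v\<close> and converge
  to \<open>X v\<close> in probability. Almost sure convergence along a subsequence lets the limit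
  inherit their measurability.\<close>

lemma X_noise_representation:
  obtains Y where "Y \<in> borel_measurable (sigma_gen M N (ancestors E {v}))" "AE \<omega> in M. X v \<omega> = Y \<omega>"
proof -
  obtain i t where v: "v = (i, t)" by (cases v)
  have root: "\<And>z. det (char_matrix p \<Phi> z) = 0 \<Longrightarrow> norm z < 1"
    using var by (auto simp: VAR_process_def)
  obtain \<psi> where \<psi>: "\<And>j. (\<lambda>n. \<psi> n j) \<longlonglongrightarrow> 0"
    and inv: "\<And>n j. (\<Sum>k\<le>n. \<Sum>l\<in>UNIV. \<psi> (n - k) l * lag_coeff p \<Phi> k l j) = (if n = 0 \<and> j = i then 1 else 0)"
    by (rule lag_inverse[OF ac root, where i = i]) (assumption, rule that)
  let ?\<A> = "sigma_gen M N (ancestors E {v})"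
  define Y where "Y n \<omega> = (\<Sum>m<n. \<Sum>l\<in>UNIV. \<psi> m l * N (l, t - int m) \<omega>)" for n \<omega>
  define Z where "Z n \<omega> = (\<Sum>k\<le>p. \<Sum>r\<in>{1..k}. \<Sum>j\<in>UNIV. (\<Sum>l\<in>UNIV. \<psi> (n - r) l * lag_coeff p \<Phi> k l j) * X (j, t - int (n - r + k)) \<omega>)" for n \<omega>
  have Ym: "Y n \<in> borel_measurable ?\<A>" for n
    unfolding Y_def
  proof (intro borel_measurable_sum)
    fix m l
    show "(\<lambda>\<omega>. \<psi> m l * N (l, t - int m) \<omega>) \<in> borel_measurable ?\<A>"
    proof (cases "\<psi> m l = 0")
      case False
      then have "(l, t - int m) \<in> ancestors E {v}"
        using lag_inverse_ancestor[OF ac inv False, of t] v by (simp add: ancestors_def)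
      from measurable_sigma_gen[OF this] show ?thesis by (rule borel_measurable_times[OF borel_measurable_const])
    qed simp
  qed
  have "small_seq Z"
    unfolding Z_def
  proof (intro small_seq_sum)
    fix k r j
    show "small_seq (\<lambda>n \<omega>. (\<Sum>l\<in>UNIV. \<psi> (n - r) l * lag_coeff p \<Phi> k l j) * X (j, t - int (n - r + k)) \<omega>)"
    proof (rule small_seq_mult)
      have *: "(\<lambda>n. \<Sum>l\<in>UNIV. \<psi> (n - r) l * lag_coeff p \<Phi> k l j) \<longlonglongrightarrow> (\<Sum>l\<in>UNIV. 0 * lag_coeff p \<Phi> k l j)"
      proof (intro tendsto_sum tendsto_mult tendsto_const)
        fix l
        show "(\<lambda>n. \<psi> (n - r) l) \<longlonglongrightarrow> 0"
          using \<psi>[of l] by (rule seq_offset_neg)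
      qed
      from * show "(\<lambda>n. \<Sum>l\<in>UNIV. \<psi> (n - r) l * lag_coeff p \<Phi> k l j) \<longlonglongrightarrow> 0" by simp
      show "distr M borel (X (j, t - int (n - r + k))) = distr M borel (X (j, 0))" for n by (rule distr_X)
    qed simp
  qed
  then obtain r where r: "strict_mono r" "AE \<omega> in M. (\<lambda>n. Z (r n) \<omega>) \<longlonglongrightarrow> 0"
    by (rule small_seq_AE_subseq)
  have "AE \<omega> in M. X v \<omega> = lim (\<lambda>n. Y (r n) \<omega>)"
    using r(2)
  proof eventually_elim
    case (elim \<omega>)
    have "eventually (\<lambda>n. X v \<omega> + Z (r n) \<omega> = Y (r n) \<omega>) sequentially"
    proof (rule eventually_sequentiallyI[of "Suc p"])
      fix n assume "Suc p \<le> n"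
      then have "p < r n" using seq_suble[OF r(1), of n] by linarith
      then show "X v \<omega> + Z (r n) \<omega> = Y (r n) \<omega>"
        unfolding v Z_def Y_def by (rule truncated_inverse[OF inv, symmetric])
    qed
    moreover have "(\<lambda>n. X v \<omega> + Z (r n) \<omega>) \<longlonglongrightarrow> X v \<omega>"
      using tendsto_add[OF tendsto_const elim, of "X v \<omega>"] by simp
    ultimately have "(\<lambda>n. Y (r n) \<omega>) \<longlonglongrightarrow> X v \<omega>" using tendsto_cong by fast
    then show ?case by (simp add: limI)
  qed
  moreover have "(\<lambda>\<omega>. lim (\<lambda>n. Y (r n) \<omega>)) \<in> borel_measurable ?\<A>"
    using Ym by (rule borel_measurable_lim_metric)
  ultimately show thesis using that by blast
qed

section \<open>Independence derived from the noise representation\<close>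

lemma subalgebra_N: "subalgebra M (sigma_gen M N V)"
  by (rule subalgebra_sigma_gen) simp

lemma subalgebra_X: "subalgebra M (sigma_gen M X V)"
  by (rule subalgebra_sigma_gen) simp

lemma sigma_gen_X_subset_ae_algebra:
  "sets (sigma_gen M X V) \<subseteq> sets (ae_algebra (sigma_gen M N (ancestors E V)))"
proof (rule sigma_gen_subset)
  fix v assume v: "v \<in> V"
  obtain Y where Y: "Y \<in> borel_measurable (sigma_gen M N (ancestors E {v}))" "AE \<omega> in M. X v \<omega> = Y \<omega>"
    by (rule X_noise_representation)
  have "subalgebra (sigma_gen M N (ancestors E V)) (sigma_gen M N (ancestors E {v}))"
    using v sigma_gen_mono[of "ancestors E {v}" "ancestors E V"]
    by (auto simp: subalgebra_def ancestors_def)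
  from measurable_from_subalg[OF this Y(1)]
  show "X v \<in> borel_measurable (ae_algebra (sigma_gen M N (ancestors E V)))"
    by (rule borel_measurable_ae_algebra[OF subalgebra_N _ X_measurable Y(2)])
qed simp

text \<open>Up to null sets, both sides are functions of the noise on disjoint sets of
  nodes.\<close>

lemma indep_X_X:
  assumes "ancestors E V \<inter> ancestors E W = {}"
    and "F \<in> sets (sigma_gen M X V)" "G \<in> sets (sigma_gen M X W)"
  shows "prob (F \<inter> G) = prob F * prob G"
  using assms(2,3) sigma_gen_X_subset_ae_algebra
  by (intro indep_ae_algebra[OF subalgebra_N subalgebra_N indep_sigma_gen[OF indep_vars_N assms(1)]]) auto

text \<open>The noise at \<open>v\<close> does not enter the representation of any variable in
  \<open>W\<close>. Its own algebra is embedded in an \<open>ae_algebra\<close> only so that the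
  same independence lemma applies.\<close>

lemma indep_N_X:
  assumes "v \<notin> ancestors E W"
    and "F \<in> sets (sigma_gen M N {v})" "G \<in> sets (sigma_gen M X W)"
  shows "prob (F \<inter> G) = prob F * prob G"
proof -
  have "F \<in> sets (ae_algebra (sigma_gen M N {v}))"
    using assms(2) subalgebra_N[of "{v}"]
    by (auto simp: sets_ae_algebra[OF subalgebra_N] subalgebra_def intro!: bexI[of _ F])
  then show ?thesis
    using assms sigma_gen_X_subset_ae_algebra
    by (intro indep_ae_algebra[OF subalgebra_N subalgebra_N indep_sigma_gen[OF indep_vars_N]]) auto
qed

lemma subalgebra_sigma_gen_mono:
  "V \<subseteq> W \<Longrightarrow> subalgebra (sigma_gen M X W) (sigma_gen M X V)"
  by (simp add: subalgebra_def sigma_gen_mono)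

text \<open>The first algebra includes \<open>R\<close>, as \<open>cind\<close> expresses
  conditional independence only when its third algebra is contained in its first.\<close>

definition ci :: "('d \<times> int) set \<Rightarrow> ('d \<times> int) set \<Rightarrow> ('d \<times> int) set \<Rightarrow> bool" where
  "ci P Q R = cind M (sigma_gen M X (P \<union> R)) (sigma_gen M X Q) (sigma_gen M X R)"

lemma ci_sym: "ci P Q R \<Longrightarrow> ci Q P R"
  unfolding ci_def
  by (erule cind_sym[OF _ subalgebra_X subalgebra_X subalgebra_X])
    (rule sigma_gen_Un_subset sigma_gen_mono Un_upper1 Un_upper2)+

text \<open>By the structural equation \<open>X v\<close> is a function of its parents in
  \<open>P \<union> R\<close> and of \<open>N v\<close>, and \<open>N v\<close> is independent of
  everything present because \<open>v\<close> is no ancestor of it.\<close>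

lemma ci_add_node:
  assumes ci: "ci P Q R" and pa: "\<And>u. (u, v) \<in> E \<Longrightarrow> u \<in> P \<union> R"
    and v: "v \<notin> ancestors E (P \<union> Q \<union> R)"
  shows "ci (insert v P) Q R"
  unfolding ci_def
proof (rule cind_extend[OF ci[unfolded ci_def] subalgebra_X[of "P \<union> Q \<union> R"] subalgebra_N[of "{v}"]])
  let ?K = "sigma_gen M X (P \<union> R)" and ?T = "sigma_gen M N {v}"
  let ?S = "sigma (space M) (pairwise_Int (sets ?K) (sets ?T))"
  show "subalgebra (sigma_gen M X (P \<union> Q \<union> R)) ?K"
    "subalgebra (sigma_gen M X (P \<union> Q \<union> R)) (sigma_gen M X Q)"
    "subalgebra (sigma_gen M X (P \<union> Q \<union> R)) (sigma_gen M X R)"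
    by (auto intro!: subalgebra_sigma_gen_mono)
  show "prob (D \<inter> F) = prob D * prob F"
    if "D \<in> sets ?T" "F \<in> sets (sigma_gen M X (P \<union> Q \<union> R))" for D F
    using indep_N_X[OF v that] .
  have XK: "X u \<in> borel_measurable ?S" if "u \<in> P \<union> R" for u
    by (rule measurable_from_subalg[OF subalgebra_sigma_pairwise_Int(1) measurable_sigma_gen[OF that]]) simp_all
  have NT: "N v \<in> borel_measurable ?S"
    by (rule measurable_from_subalg[OF subalgebra_sigma_pairwise_Int(2) measurable_sigma_gen]) simp_all
  obtain i t where it: "v = (i, t)" by (cases v)
  have "(\<lambda>\<omega>. N (i, t) \<omega> + (\<Sum>k\<le>p. \<Sum>j\<in>UNIV. \<Phi> k $ i $ j * X (j, t - int k) \<omega>)) \<in> borel_measurable ?S"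
  proof (intro borel_measurable_add borel_measurable_sum)
    show "N (i, t) \<in> borel_measurable ?S" using NT it by simp
    fix k j assume "k \<in> {..p}"
    show "(\<lambda>\<omega>. \<Phi> k $ i $ j * X (j, t - int k) \<omega>) \<in> borel_measurable ?S"
    proof (cases "\<Phi> k $ i $ j = 0")
      case False
      then have "((j, t - int k), v) \<in> E" using \<open>k \<in> {..p}\<close> it by (auto simp: full_time_graph_def)
      from XK[OF pa[OF this]] show ?thesis by (intro borel_measurable_times) auto
    qed simp
  qed
  then have "X v \<in> borel_measurable ?S" by (simp add: it flip: structural_equation)
  then show "sets (sigma_gen M X (insert v P \<union> R)) \<subseteq> sigma_sets (space M) (pairwise_Int (sets ?K) (sets ?T))"
    using XK by (intro sigma_gen_subset_pairwise_Int) auto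
qed

text \<open>Moving \<open>v\<close> leaves the first algebra unchanged; only the conditioning
  algebra grows.\<close>

lemma ci_weak_union: "ci (insert v P) Q R \<Longrightarrow> ci P Q (insert v R)"
  unfolding ci_def
  by (erule cind_mono) (auto intro!: subalgebra_sigma_gen_mono)

text \<open>The new node always enters on the \<open>P\<close> side first; if it belongs to
  \<open>R\<close>, weak union then moves it into the conditioning set.\<close>

lemma ci_grow:
  assumes ci: "ci (P \<inter> W) (Q \<inter> W) (R \<inter> W)" and disj: "P \<inter> Q = {}" "P \<inter> R = {}" "Q \<inter> R = {}"
    and pa: "\<And>u. (u, v) \<in> E \<Longrightarrow> u \<in> W" and v: "v \<notin> ancestors E W"
    and fam: "family E v \<subseteq> P \<union> R"
  shows "ci (P \<inter> insert v W) (Q \<inter> insert v W) (R \<inter> insert v W)"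
proof -
  have "ci (insert v (P \<inter> W)) (Q \<inter> W) (R \<inter> W)"
    using ci
  proof (rule ci_add_node)
    show "u \<in> P \<inter> W \<union> R \<inter> W" if "(u, v) \<in> E" for u
      using fam pa that by (auto simp: family_def)
    show "v \<notin> ancestors E (P \<inter> W \<union> Q \<inter> W \<union> R \<inter> W)"
      using v by (auto simp: ancestors_def)
  qed
  moreover have "v \<in> P \<union> R" using fam by (auto simp: family_def)
  ultimately show ?thesis
    using disj ci_weak_union by (cases "v \<in> P") (auto simp: Int_insert_right)
qed

text \<open>A sink of \<open>F\<close> is removed: it is no ancestor of the remaining nodes and has
  all its parents among them, so it can be added back last. A family on the \<open>Q\<close> side is
  treated by symmetry.\<close>

lemma ci_closed_set:
  assumes disj: "P \<inter> Q = {}" "P \<inter> R = {}" "Q \<inter> R = {}"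
    and base: "ci (P \<inter> W) (Q \<inter> W) (R \<inter> W)"
    and W: "\<And>x y. (x, y) \<in> E \<Longrightarrow> y \<in> W \<Longrightarrow> x \<in> W"
    and F: "finite F" "F \<inter> W = {}" "\<And>x y. (x, y) \<in> E \<Longrightarrow> y \<in> W \<union> F \<Longrightarrow> x \<in> W \<union> F"
    and fam: "\<And>v. v \<in> F \<Longrightarrow> family E v \<subseteq> P \<union> R \<or> family E v \<subseteq> Q \<union> R"
  shows "ci (P \<inter> (W \<union> F)) (Q \<inter> (W \<union> F)) (R \<inter> (W \<union> F))"
  using F fam
proof (induction F rule: finite_psubset_induct)
  case (psubset F)
  show ?case
  proof (cases "F = {}")
    case True
    then show ?thesis using base by simp
  next
    case False
    then obtain v where v: "v \<in> F" "\<And>u. u \<in> F \<Longrightarrow> (v, u) \<notin> E"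
      using finite_acyclic_sink[OF ac psubset.hyps(1)] by metis
    define F' where "F' = F - {v}"
    have cl: "x \<in> W \<union> F'" if "(x, y) \<in> E" "y \<in> W \<union> F'" for x y
    proof -
      have "x \<in> W \<union> F" using that psubset.prems(2)[OF that(1)] by (auto simp: F'_def)
      moreover have "x \<noteq> v"
      proof
        assume "x = v"
        then show False using that v psubset.prems(1) W[OF that(1)] unfolding F'_def by blast
      qed
      ultimately show ?thesis by (auto simp: F'_def)
    qed
    have IH: "ci (P \<inter> (W \<union> F')) (Q \<inter> (W \<union> F')) (R \<inter> (W \<union> F'))"
    proof (rule psubset.IH)
      show "F' \<subset> F" using v by (auto simp: F'_def)
      show "F' \<inter> W = {}" using psubset.prems by (auto simp: F'_def)
      show "x \<in> W \<union> F'" if "(x, y) \<in> E" "y \<in> W \<union> F'" for x y using cl that by blast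
      show "family E u \<subseteq> P \<union> R \<or> family E u \<subseteq> Q \<union> R" if "u \<in> F'" for u
        using psubset.prems(3) that by (auto simp: F'_def)
    qed
    have pa: "u \<in> W \<union> F'" if "(u, v) \<in> E" for u
      using psubset.prems(2)[OF that] v(1) v(2)[OF v(1)] that by (auto simp: F'_def)
    have nv: "v \<notin> ancestors E (W \<union> F')"
      using closed_imp_ancestors[of E "W \<union> F'"] cl v psubset.prems(1) by (auto simp: F'_def)
    have ins: "W \<union> F = insert v (W \<union> F')" using v by (auto simp: F'_def)
    from psubset.prems(3)[OF v(1)] show ?thesis
    proof
      assume "family E v \<subseteq> P \<union> R"
      then show ?thesis unfolding ins using ci_grow[OF IH disj pa nv] by blast
    next
      assume "family E v \<subseteq> Q \<union> R"
      then show ?thesis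
        unfolding ins using ci_grow[OF ci_sym[OF IH] _ disj(3,2) pa nv] disj(1) ci_sym by blast
    qed
  qed
qed

lemma edge_time: "(x, y) \<in> E \<Longrightarrow> snd x \<le> snd y"
  by (auto simp: full_time_graph_def)

lemma global_markov:
  assumes fin: "finite A" "finite B" "finite C"
    and disj: "A \<inter> B = {}" "B \<inter> C = {}"
    and sep: "d_separated E A C B"
  shows "cond_indep_vars M X A C B"
proof -
  define An where "An = ancestors E (A \<union> B \<union> C)"
  obtain P Q where PQ: "P \<inter> Q = {}" "P \<union> Q = An - B" "A \<subseteq> P" "C \<subseteq> Q"
    and fam: "\<And>w. w \<in> An \<Longrightarrow> family E w \<subseteq> P \<union> B \<or> family E w \<subseteq> Q \<union> B"
    using d_separated_imp_split[OF ac sep disj] unfolding An_def by metis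
  have An: "x \<in> An" if "(x, y) \<in> E" "y \<in> An" for x y
    using that by (auto simp: An_def ancestors_def dest: converse_rtrancl_into_rtrancl)
  have BAn: "B \<subseteq> An" by (auto simp: An_def ancestors_def)
  \<comment> \<open>Inserting 0 covers an empty \<open>B\<close>.\<close>
  define t0 where "t0 = Min (insert 0 (snd ` B))"
  have t0: "t0 \<le> snd b" if "b \<in> B" for b using that fin by (auto simp: t0_def)
  define W where "W = {v \<in> An. snd v < t0}"
  define F where "F = {v \<in> An. t0 \<le> snd v}"
  have WF: "W \<union> F = An" "F \<inter> W = {}" by (auto simp: W_def F_def)
  \<comment> \<open>Edges never go back in time, so no ancestor is later than the latest node of
    \<open>A \<union> B \<union> C\<close>, and each time carries finitely many nodes.\<close>
  have "finite F"
  proof (rule finite_subset)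
    define T where "T = Max (insert 0 (snd ` (A \<union> B \<union> C)))"
    have "snd x \<le> snd y" if "(x, y) \<in> E\<^sup>*" for x y
      using that by (induction rule: rtrancl_induct) (auto dest: edge_time)
    moreover have "snd y \<le> T" if "y \<in> A \<union> B \<union> C" for y
      unfolding T_def using that fin by (intro Max_ge) auto
    ultimately have "snd x \<le> T" if "x \<in> An" for x
      using that unfolding An_def ancestors_def by fastforce
    then show "F \<subseteq> UNIV \<times> {t0..T}" by (auto simp: F_def)
  qed simp
  have BW: "B \<inter> W = {}" using t0 by (fastforce simp: W_def)
  have Wcl: "x \<in> W" if "(x, y) \<in> E" "y \<in> W" for x y
    using that edge_time[OF that(1)] An by (auto simp: W_def)
  \<comment> \<open>Before \<open>t0\<close> there is no node of \<open>B\<close>, so the family of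
    \<open>y\<close> lies entirely on the side of \<open>y\<close>.\<close>
  have closed: "ancestors E (V \<inter> W) = V \<inter> W"
    if V: "V = P \<or> V = Q" for V
  proof (rule closed_imp_ancestors)
    fix x y assume xy: "(x, y) \<in> E" "y \<in> V \<inter> W"
    then have x: "x \<in> W" using Wcl by blast
    then have "x \<notin> B" using BW by blast
    have "x \<in> family E y" "y \<in> family E y" using xy by (auto simp: family_def)
    moreover have "y \<in> An" "y \<notin> B" using xy BW by (auto simp: W_def)
    ultimately show "x \<in> V \<inter> W" using fam[of y] x \<open>x \<notin> B\<close> xy V PQ(1) by blast
  qed
  have "ci (P \<inter> W) (Q \<inter> W) (B \<inter> W)"
    unfolding ci_def BW Un_empty_right
  proof (rule cind_indep[OF indep_X_X subalgebra_X subalgebra_X])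
    show "ancestors E (P \<inter> W) \<inter> ancestors E (Q \<inter> W) = {}"
      using closed PQ(1) by auto
  qed
  then have "ci (P \<inter> (W \<union> F)) (Q \<inter> (W \<union> F)) (B \<inter> (W \<union> F))"
  proof (rule ci_closed_set[rotated 3])
    show "P \<inter> Q = {}" "P \<inter> B = {}" "Q \<inter> B = {}" using PQ by auto
    show "family E v \<subseteq> P \<union> B \<or> family E v \<subseteq> Q \<union> B" if "v \<in> F" for v
      using fam that by (auto simp: F_def)
    show "x \<in> W" if "(x, y) \<in> E" "y \<in> W" for x y using Wcl that by blast
    show "x \<in> W \<union> F" if "(x, y) \<in> E" "y \<in> W \<union> F" for x y using An that WF by auto
  qed fact+
  moreover have "P \<inter> (W \<union> F) = P" "Q \<inter> (W \<union> F) = Q" "B \<inter> (W \<union> F) = B"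
    using WF PQ BAn by auto
  ultimately have ci: "ci P Q B" by simp
  show ?thesis
    unfolding cond_indep_vars_def
  proof (intro ballI)
    fix F G assume FG: "F \<in> sets (sigma_gen M X A)" "G \<in> sets (sigma_gen M X C)"
    have "F \<in> sets (sigma_gen M X (P \<union> B))"
      using FG(1) sigma_gen_mono[of A "P \<union> B"] PQ(3) by auto
    moreover have "G \<in> sets (sigma_gen M X Q)"
      using FG(2) sigma_gen_mono[OF PQ(4)] by auto
    ultimately show "AE \<omega> in M. real_cond_exp M (sigma_gen M X B) (indicator (F \<inter> G)) \<omega> =
        real_cond_exp M (sigma_gen M X B) (indicator F) \<omega> * real_cond_exp M (sigma_gen M X B) (indicator G) \<omega>"
      by (intro cind_imp_cond_exp_mult[OF ci[unfolded ci_def] subalgebra_X subalgebra_X subalgebra_X])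
        (auto intro!: sigma_gen_mono)
  qed
qed

end

theorem theorem2:
  fixes M :: "'w measure" and p :: nat
    and \<Phi> :: "nat \<Rightarrow> real^'d^'d::finite"
    and \<epsilon> S :: "int \<Rightarrow> 'w \<Rightarrow> real^'d"
    and A B C :: "('d \<times> int) set"
  assumes "prob_space M"
    and "VAR_process M p \<Phi> \<epsilon> S"
    and "acyclic (full_time_graph p \<Phi>)"
    and "finite A" and "finite B" and "finite C"
    and "A \<inter> B = {}" and "A \<inter> C = {}" and "B \<inter> C = {}"
    and "d_separated (full_time_graph p \<Phi>) A C B"
  shows "cond_indep_vars M (node_var S) A C B"
proof -
  interpret VAR M p \<Phi> \<epsilon> S
    using assms(1-3) by (intro VAR.intro VAR_axioms.intro)
  show ?thesis using global_markov assms(4-7,9,10) by blast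
qed

end
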